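(* Let $n\ge3$, $\mathbf{char}(q)=\ell\ge3$ and $m\ge1$ an integer. For the quantum de Rham subcomplex $(\Omega_q(n,\mathbf m),d^\bullet)$ $$0\to\Omega_q(n,\mathbf m)^{(0)}\xrightarrow{d^0}\cdots\xrightarrow{d^{s-1}}\Omega_q(n,\mathbf m)^{(s)}\xrightarrow{d^s}\Omega_q(n,\mathbf m)^{(s+1)}\xrightarrow{d^{s+1}}\cdots\to\Omega_q(n,\mathbf m)^{(n)}\xrightarrow{d^n}0,$$ one has, for $s=0,1,\dots,n$, $$H^s(\Omega_q(n,\mathbf m))=\ker d^s/\mathrm{Im}\,d^{s-1}\cong\bigoplus_{1\le i_1<\cdots<i_s\le n}k\,\bigl[x^{(\sum_{j=1}^s(m\ell-1)\varepsilon_{i_j})}\otimes dx_{i_1}\wedge\cdots\wedge dx_{i_s}\bigr]$$ as $k$-vector spaces (where $[\,\cdot\,]$ denotes the cohomology class), and $\dim H^s(\Omega_q(n,\mathbf m))=\binom ns$.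
   Context: $k$ is an algebraically closed field of characteristic $0$ and $q\in k^*$, $q\ne\pm1$. $[a]=\frac{q^a-q^{-a}}{q-q^{-1}}$; $\mathbf{char}(q)$ is the smallest positive integer $\ell$ with $[\ell]=0$ (so $q$ is either a primitive $2\ell$-th root of unity, or $\ell$ is odd and $q$ is a primitive $\ell$-th root of unity). $\mathcal A_q(n)$ is the $k$-vector space with basis $\{x^{(\alpha)}\mid\alpha\in\mathbb Z_+^n\}$ ($\mathbb Z_+$ = nonnegative integers); $x^{(\beta)}:=0$ if $\beta\notin\mathbb Z_+^n$; $\varepsilon_i$ is the $i$-th unit vector. For $\alpha,\beta\in\mathbb Z^n$, $\alpha*\beta=\sum_{j=1}^{n-1}\sum_{i>j}\alpha_i\beta_j$, so $\varepsilon_i*\beta=\sum_{j<i}\beta_j$. $\wedge_q(n)$ is the quantum exterior algebra $k\{dx_1,\dots,dx_n\}/((dx_i)^2,\ dx_jdx_i+q^{-1}dx_idx_j\ (i<j))$, product written $\wedge$; $\wedge_q(n)_{(s)}$ is its degree $s$ part, with basis $dx_{i_1}\wedge\cdots\wedge dx_{i_s}$, $i_1<\cdots<i_s$. $\Omega_q(n)^{(s)}=\mathcal A_q(n)\otimes_k\wedge_q(n)_{(s)}$, and $d^s:\Omega_q(n)^{(s)}\to\Omega_q(n)^{(s+1)}$ is the linear map $$d^s(x^{(\alpha)}\otimes dx_{i_1}\wedge\cdots\wedge dx_{i_s})=\sum_{j=1}^nq^{-\varepsilon_j*\alpha}x^{(\alpha-\varepsilon_j)}\otimes dx_j\wedge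 dx_{i_1}\wedge\cdots\wedge dx_{i_s},$$ with $d^n=0$, $d^{-1}=0$. $\mathcal A_q(n,\mathbf m)=\mathrm{span}_k\{x^{(\alpha)}\mid\alpha\in\mathbb Z_+^n,\ \alpha_i\le m\ell-1\ \forall i\}$, $\Omega_q(n,\mathbf m)^{(s)}=\mathcal A_q(n,\mathbf m)\otimes\wedge_q(n)_{(s)}$; these are stable under the $d^s$ and form the subcomplex. *)

theory Defs
  imports
    "Jordan_Normal_Form.VS_Connect"
    "HOL-Algebra.QuotRing"
    "HOL-Library.Poly_Mapping"
    "HOL-Library.Cardinality"
begin

definition qint :: "'k::field \<Rightarrow> int \<Rightarrow> 'k" where
  "qint q a = (q powi a - q powi (- a)) / (q - inverse q)"

text \<open>The value 0 stands for ``no such integer exists''.\<close>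

definition qchar :: "'k::field \<Rightarrow> nat" where
  "qchar q = (if \<exists>l>0. qint q (int l) = 0 then LEAST l. l > 0 \<and> qint q (int l) = 0 else 0)"

text \<open>
  Throughout, the index set \<open>{1, \<dots>, n}\<close> is a finite linearly ordered type \<open>'n\<close> with
  \<open>n = CARD('n)\<close>.
\<close>

definition eps :: "'n \<Rightarrow> 'n \<Rightarrow> int" where
  "eps j = (\<lambda>i. if i = j then 1 else 0)"

definition star :: "('n::{finite,linorder} \<Rightarrow> int) \<Rightarrow> ('n \<Rightarrow> int) \<Rightarrow> int" where
  "star \<alpha> \<beta> = (\<Sum>j\<in>UNIV. \<Sum>i\<in>{i. i > j}. \<alpha> i * \<beta> j)"

text \<open>
  The free monoid, written additively so that \<open>'n free_word \<Rightarrow>\<^sub>0 'k\<close> is, with the library's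
  convolution product, the free associative algebra on generators indexed by \<open>'n\<close>.
\<close>

datatype 'n free_word = Free_Word (letters: "'n list")

instantiation free_word :: (type) monoid_add
begin

definition zero_free_word :: "'a free_word" where
  "0 = Free_Word []"

definition plus_free_word :: "'a free_word \<Rightarrow> 'a free_word \<Rightarrow> 'a free_word" where
  "v + w = Free_Word (letters v @ letters w)"

instance
  by standard (simp_all add: zero_free_word_def plus_free_word_def)

end

definition scalar :: "'k::field \<Rightarrow> 'n free_word \<Rightarrow>\<^sub>0 'k" where
  "scalar c = Poly_Mapping.single 0 c"

definition gen :: "'n \<Rightarrow> 'n free_word \<Rightarrow>\<^sub>0 'k::field" where
  "gen i = Poly_Mapping.single (Free_Word [i]) 1"

definition free_algebra :: "('k::field, 'n free_word \<Rightarrow>\<^sub>0 'k) module" where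
  "free_algebra =
     \<lparr>carrier = UNIV, mult = (*), one = 1, zero = 0, add = (+), smult = (\<lambda>c f. scalar c * f)\<rparr>"

text \<open>
  If \<open>M\<close> is an algebra and \<open>N\<close> a two-sided ideal, this is the quotient algebra.  If \<open>M\<close> is only
  a module and \<open>N\<close> a submodule, it is the quotient module, and the fields \<open>mult\<close> and \<open>one\<close>
  carry no meaning.
\<close>

definition quot_module :: "('k, 'v) module \<Rightarrow> 'v set \<Rightarrow> ('k, 'v set) module" where
  "quot_module M N =
     ring.extend (M Quot N) (module.fields (\<lambda>c X. \<Union>x\<in>X. N +>\<^bsub>M\<^esub> (c \<odot>\<^bsub>M\<^esub> x)))"

definition wedge_rels :: "'k::field \<Rightarrow> ('n::{finite,linorder} free_word \<Rightarrow>\<^sub>0 'k) set" where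
  "wedge_rels q =
     {gen i * gen i | i. True} \<union>
     {gen j * gen i + scalar (inverse q) * (gen i * gen j) | i j. i < j}"

definition wedge_ideal :: "'k::field \<Rightarrow> ('n::{finite,linorder} free_word \<Rightarrow>\<^sub>0 'k) set" where
  "wedge_ideal q = Idl\<^bsub>free_algebra\<^esub> (wedge_rels q)"

definition wedge ::
    "'k::field \<Rightarrow> ('k, ('n::{finite,linorder} free_word \<Rightarrow>\<^sub>0 'k) set) module" where
  "wedge q = quot_module free_algebra (wedge_ideal q)"

definition dx :: "'k::field \<Rightarrow> 'n::{finite,linorder} \<Rightarrow> ('n free_word \<Rightarrow>\<^sub>0 'k) set" where
  "dx q i = wedge_ideal q +>\<^bsub>free_algebra\<^esub> gen i"

definition dx_wedge :: "'k::field \<Rightarrow> 'n::{finite,linorder} list \<Rightarrow> ('n free_word \<Rightarrow>\<^sub>0 'k) set" where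
  "dx_wedge q js = foldr (\<otimes>\<^bsub>wedge q\<^esub>) (map (dx q) js) \<one>\<^bsub>wedge q\<^esub>"

definition wedge_deg ::
    "'k::field \<Rightarrow> nat \<Rightarrow> ('k, ('n::{finite,linorder} free_word \<Rightarrow>\<^sub>0 'k) set) module" where
  "wedge_deg q s = (wedge q)
     \<lparr>carrier := {wedge_ideal q +>\<^bsub>free_algebra\<^esub> f | f. \<forall>w\<in>Poly_Mapping.keys f. length (letters w) = s}\<rparr>"

text \<open>
  The tensor product with \<open>V\<close> of the vector space with basis \<open>B\<close>: a finite sum
  \<open>\<Sum>b\<in>B. b \<otimes> v\<^sub>b\<close> is the finitely supported family \<open>(v\<^sub>b)\<close>.
\<close>

definition free_tensor :: "'b set \<Rightarrow> ('k, 'v) module \<Rightarrow> ('k, 'b \<Rightarrow> 'v) module" where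
  "free_tensor B V =
     \<lparr>carrier = {f. (\<forall>b. f b \<in> carrier V) \<and> finite {b. f b \<noteq> \<zero>\<^bsub>V\<^esub>} \<and> (\<forall>b. b \<notin> B \<longrightarrow> f b = \<zero>\<^bsub>V\<^esub>)},
      mult = undefined, one = undefined,
      zero = (\<lambda>b. \<zero>\<^bsub>V\<^esub>), add = (\<lambda>f g b. f b \<oplus>\<^bsub>V\<^esub> g b), smult = (\<lambda>c f b. c \<odot>\<^bsub>V\<^esub> f b)\<rparr>"

text \<open>
  The element \<open>x\<^sup>(\<^sup>\<beta>\<^sup>) \<otimes> v\<close> for an integer vector \<open>\<beta>\<close>; it is zero if \<open>\<beta>\<close> has a negative entry,
  since then no \<open>\<alpha>\<close> matches.
\<close>

definition x_tensor ::
    "('k, 'v) module \<Rightarrow> ('n \<Rightarrow> int) \<Rightarrow> 'v \<Rightarrow> ('n \<Rightarrow> nat) \<Rightarrow> 'v" where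
  "x_tensor V \<beta> v = (\<lambda>\<alpha>. if (\<forall>i. int (\<alpha> i) = \<beta> i) then v else \<zero>\<^bsub>V\<^esub>)"

definition Omega ::
    "'k::field \<Rightarrow> nat \<Rightarrow>
     ('k, ('n::{finite,linorder} \<Rightarrow> nat) \<Rightarrow> ('n free_word \<Rightarrow>\<^sub>0 'k) set) module" where
  "Omega q s = free_tensor UNIV (wedge_deg q s)"

text \<open>
  The linear extension of the formula for \<open>x\<^sup>(\<^sup>\<alpha>\<^sup>) \<otimes> dx\<^sub>i\<^sub>1 \<and> \<dots> \<and> dx\<^sub>i\<^sub>s\<close>; the coefficient
  \<open>\<omega> \<alpha>\<close> is an element of degree \<open>s\<close> of the exterior algebra.  As that algebra vanishes in degree
  \<open>n + 1\<close>, the map is zero for \<open>s = n\<close>.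
\<close>

definition dR ::
    "'k::field \<Rightarrow> nat \<Rightarrow> (('n::{finite,linorder} \<Rightarrow> nat) \<Rightarrow> ('n free_word \<Rightarrow>\<^sub>0 'k) set)
     \<Rightarrow> (('n \<Rightarrow> nat) \<Rightarrow> ('n free_word \<Rightarrow>\<^sub>0 'k) set)" where
  "dR q s \<omega> =
     (\<Oplus>\<^bsub>Omega q (Suc s)\<^esub> \<alpha> \<in> {\<alpha>. \<omega> \<alpha> \<noteq> \<zero>\<^bsub>wedge q\<^esub>}.
        \<Oplus>\<^bsub>Omega q (Suc s)\<^esub> j \<in> UNIV.
          q powi (- star (eps j) (\<lambda>i. int (\<alpha> i)))
            \<odot>\<^bsub>Omega q (Suc s)\<^esub> x_tensor (wedge q) (\<lambda>i. int (\<alpha> i) - eps j i) (dx q j \<otimes>\<^bsub>wedge q\<^esub> \<omega> \<alpha>))"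

definition Omega_sub ::
    "'k::field \<Rightarrow> nat \<Rightarrow> nat \<Rightarrow>
     ('k, ('n::{finite,linorder} \<Rightarrow> nat) \<Rightarrow> ('n free_word \<Rightarrow>\<^sub>0 'k) set) module" where
  "Omega_sub q m s = free_tensor {\<alpha>. \<forall>i. \<alpha> i \<le> m * qchar q - 1} (wedge_deg q s)"

definition cocycles ::
    "'k::field \<Rightarrow> nat \<Rightarrow> nat \<Rightarrow> (('n::{finite,linorder} \<Rightarrow> nat) \<Rightarrow> ('n free_word \<Rightarrow>\<^sub>0 'k) set) set" where
  "cocycles q m s = {\<omega> \<in> carrier (Omega_sub q m s). dR q s \<omega> = \<zero>\<^bsub>Omega_sub q m (Suc s)\<^esub>}"

definition coboundaries ::
    "'k::field \<Rightarrow> nat \<Rightarrow> nat \<Rightarrow> (('n::{finite,linorder} \<Rightarrow> nat) \<Rightarrow> ('n free_word \<Rightarrow>\<^sub>0 'k) set) set" where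
  "coboundaries q m s =
     (case s of 0 \<Rightarrow> {\<zero>\<^bsub>Omega_sub q m 0\<^esub>} | Suc r \<Rightarrow> dR q r ` carrier (Omega_sub q m r))"

definition cohomology ::
    "'k::field \<Rightarrow> nat \<Rightarrow> nat \<Rightarrow>
     ('k, (('n::{finite,linorder} \<Rightarrow> nat) \<Rightarrow> ('n free_word \<Rightarrow>\<^sub>0 'k) set) set) module" where
  "cohomology q m s =
     quot_module ((Omega_sub q m s)\<lparr>carrier := cocycles q m s\<rparr>) (coboundaries q m s)"

definition coh_class ::
    "'k::field \<Rightarrow> nat \<Rightarrow> nat \<Rightarrow> (('n::{finite,linorder} \<Rightarrow> nat) \<Rightarrow> ('n free_word \<Rightarrow>\<^sub>0 'k) set)
     \<Rightarrow> (('n \<Rightarrow> nat) \<Rightarrow> ('n free_word \<Rightarrow>\<^sub>0 'k) set) set" where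
  "coh_class q m s \<omega> = coboundaries q m s +>\<^bsub>Omega_sub q m s\<^esub> \<omega>"

definition incr_seqs :: "nat \<Rightarrow> 'n::{finite,linorder} list set" where
  "incr_seqs s = {js. length js = s \<and> sorted_wrt (<) js}"

definition top_form ::
    "'k::field \<Rightarrow> nat \<Rightarrow> 'n::{finite,linorder} list \<Rightarrow> ('n \<Rightarrow> nat) \<Rightarrow> ('n free_word \<Rightarrow>\<^sub>0 'k) set" where
  "top_form q m js =
     x_tensor (wedge q) (\<lambda>i. \<Sum>j\<leftarrow>js. (int m * int (qchar q) - 1) * eps j i) (dx_wedge q js)"

end

theory Submission
  imports Defs
begin

text \<open>
  In the quantum exterior algebra the increasing monomials form a basis, since the algebra acts by
  explicit left multiplication operators on the space of functions on subsets of \<open>{1, \<dots>, n}\<close>, and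
  the relations suffice to sort every word.  Give \<open>x\<^sup>(\<^sup>\<alpha>\<^sup>) \<otimes> dx\<^sub>S\<close> the multidegree
  \<open>\<beta> = \<alpha> + \<Sum>\<^sub>i\<^sub>\<in>\<^sub>S \<epsilon>\<^sub>i\<close>.  The differential preserves \<open>\<beta>\<close>, and moving \<open>dx\<^sub>j\<close> to its place
  in \<open>dx\<^sub>S\<close> combines with the power of \<open>q\<close> in its formula to a coefficient that depends on \<open>j\<close> and \<open>\<beta>\<close> only,
  up to the usual sign.  Hence each multidegree is a Koszul complex with nonzero coefficients in
  the directions \<open>j\<close> with \<open>1 \<le> \<beta>\<^sub>j \<le> N\<close>, where \<open>N = m\<ell> - 1\<close> is the bound on the exponents.  If
  there is such a direction, the complex is contractible; otherwise it is spanned by the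
  single form with exponent \<open>N\<close> exactly on \<open>S\<close>.
\<close>

section \<open>Vector spaces in coordinates\<close>

text \<open>The vector space laws are pulled back along the injective linear map
  \<open>\<phi>\<close> from a space of functions, so closure and such a map are all that has to be
  supplied for a concrete structure.\<close>

locale coordinates =
  fixes V :: "('k::field, 'v) module" and \<phi> :: "'v \<Rightarrow> 'b \<Rightarrow> 'k"
  assumes zero_closed [simp]: "\<zero>\<^bsub>V\<^esub> \<in> carrier V"
    and add_closed [simp]: "x \<in> carrier V \<Longrightarrow> y \<in> carrier V \<Longrightarrow> x \<oplus>\<^bsub>V\<^esub> y \<in> carrier V"
    and smult_closed [simp]: "x \<in> carrier V \<Longrightarrow> c \<odot>\<^bsub>V\<^esub> x \<in> carrier V"
    and coord_zero [simp]: "\<phi> \<zero>\<^bsub>V\<^esub> b = 0"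
    and coord_add [simp]:
      "x \<in> carrier V \<Longrightarrow> y \<in> carrier V \<Longrightarrow> \<phi> (x \<oplus>\<^bsub>V\<^esub> y) b = \<phi> x b + \<phi> y b"
    and coord_smult [simp]: "x \<in> carrier V \<Longrightarrow> \<phi> (c \<odot>\<^bsub>V\<^esub> x) b = c * \<phi> x b"
    and coord_inj:
      "x \<in> carrier V \<Longrightarrow> y \<in> carrier V \<Longrightarrow> (\<And>b. \<phi> x b = \<phi> y b) \<Longrightarrow> x = y"
begin

lemma abelian_group: "abelian_group V"
proof (rule abelian_groupI)
  fix x assume x: "x \<in> carrier V"
  then have "(- 1) \<odot>\<^bsub>V\<^esub> x \<oplus>\<^bsub>V\<^esub> x = \<zero>\<^bsub>V\<^esub>"
    by (intro coord_inj) auto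
  with x show "\<exists>y\<in>carrier V. y \<oplus>\<^bsub>V\<^esub> x = \<zero>\<^bsub>V\<^esub>"
    by (intro bexI[of _ "(- 1) \<odot>\<^bsub>V\<^esub> x"]) auto
qed (auto intro!: coord_inj)

lemma module: "module class_ring V"
proof (rule moduleI)
  show "cring (class_ring :: 'k ring)"
    by (rule class_cring.cring_axioms)
qed (auto simp: abelian_group algebra_simps intro!: coord_inj)

lemma vectorspace: "vectorspace class_ring V"
  by (simp add: vectorspace_def module class_field)

lemma finsum_closed_coord:
  assumes "f \<in> A \<rightarrow> carrier V"
  shows "finsum V f A \<in> carrier V \<and> \<phi> (finsum V f A) b = (\<Sum>a\<in>A. \<phi> (f a) b)"
proof -
  interpret abelian_group V by (rule abelian_group)
  show ?thesis using assms
    by (induction A rule: infinite_finite_induct) (auto simp: Pi_iff)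
qed

lemma coord_finsum:
  "f \<in> A \<rightarrow> carrier V \<Longrightarrow> \<phi> (finsum V f A) b = (\<Sum>a\<in>A. \<phi> (f a) b)"
  using finsum_closed_coord by blast

text \<open>Evaluating a linear combination at \<open>\<iota> y\<close> isolates the coefficient of
  \<open>v y\<close>, which gives independence; \<open>sep\<close> gives spanning. The map
  \<open>\<iota>\<close> lets the index type of the basis differ from that of the
  coordinates.\<close>

lemma dual_basis:
  assumes finB: "finite B" and v: "\<And>x. x \<in> B \<Longrightarrow> v x \<in> carrier V"
    and dual: "\<And>x y. x \<in> B \<Longrightarrow> y \<in> B \<Longrightarrow> \<phi> (v x) (\<iota> y) = (if x = y then 1 else 0)"
    and sep: "\<And>x y. x \<in> carrier V \<Longrightarrow> y \<in> carrier V \<Longrightarrow>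
      (\<And>b. b \<in> B \<Longrightarrow> \<phi> x (\<iota> b) = \<phi> y (\<iota> b)) \<Longrightarrow> x = y"
  shows "inj_on v B \<and> vectorspace.basis class_ring V (v ` B) \<and>
    vectorspace.dim class_ring V = card B"
proof -
  have inj: "inj_on v B"
    by (rule inj_onI) (metis dual zero_neq_one)
  interpret vectorspace class_ring V by (rule vectorspace)
  have sub: "v ` B \<subseteq> carrier V" using v by auto
  have coord_lincomb: "\<phi> (lincomb a A) (\<iota> y) = (\<Sum>x\<in>{x \<in> B. v x \<in> A}. a (v x) * \<phi> (v x) (\<iota> y))"
    if "A \<subseteq> v ` B" for a A y
  proof -
    have A: "A = v ` {x \<in> B. v x \<in> A}" using that by auto
    have "\<phi> (lincomb a A) (\<iota> y) = (\<Sum>w\<in>A. a w * \<phi> w (\<iota> y))"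
      unfolding lincomb_def using subset_trans[OF that sub]
      by (subst coord_finsum) (auto simp: subset_iff intro!: sum.cong)
    also have "\<dots> = (\<Sum>w\<in>v ` {x \<in> B. v x \<in> A}. a w * \<phi> w (\<iota> y))"
      using A by simp
    also have "\<dots> = (\<Sum>x\<in>{x \<in> B. v x \<in> A}. a (v x) * \<phi> (v x) (\<iota> y))"
      by (rule sum.reindex[unfolded o_def]) (auto intro: inj_on_subset[OF inj])
    finally show ?thesis .
  qed
  have coord_lincomb_dual: "\<phi> (lincomb a A) (\<iota> y) = a (v y)"
    if "A \<subseteq> v ` B" "y \<in> B" "v y \<in> A" for a A y
  proof -
    have "\<phi> (lincomb a A) (\<iota> y) = (\<Sum>x\<in>{x \<in> B. v x \<in> A}. if x = y then a (v x) else 0)"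
      unfolding coord_lincomb[OF that(1)] using that(2) by (intro sum.cong) (auto simp: dual)
    also have "\<dots> = a (v y)"
      using that finB by (subst sum.delta) auto
    finally show ?thesis .
  qed
  have indpt: "lin_indpt (v ` B)"
  proof
    assume "lin_dep (v ` B)"
    then obtain A a w where A: "A \<subseteq> v ` B" "w \<in> A" "a w \<noteq> 0" "lincomb a A = \<zero>\<^bsub>V\<^esub>"
      unfolding lin_dep_def by auto
    then obtain y where "y \<in> B" "w = v y" by auto
    then show False using coord_lincomb_dual[of A y a] A by auto
  qed
  have "x \<in> span (v ` B)" if x: "x \<in> carrier V" for x
  proof -
    \<comment> \<open>The only possible coefficients: by duality the coefficient at
      \<open>v b\<close> must be the coordinate of \<open>x\<close> at
      \<open>\<iota> b\<close>.\<close>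
    define a where "a w = \<phi> x (\<iota> (the_inv_into B v w))" for w
    have "lincomb a (v ` B) = x"
    proof (rule sep)
      show "lincomb a (v ` B) \<in> carrier V"
        by (rule lincomb_closed[OF sub]) auto
      show "\<phi> (lincomb a (v ` B)) (\<iota> b) = \<phi> x (\<iota> b)" if "b \<in> B" for b
        using that by (subst coord_lincomb_dual) (auto simp: a_def the_inv_into_f_f[OF inj])
    qed (rule x)
    then show ?thesis unfolding span_def using finB by fastforce
  qed
  moreover have "span (v ` B) \<subseteq> carrier V" by (rule span_is_subset2[OF sub])
  ultimately have basis: "basis (v ` B)"
    unfolding basis_def using indpt sub by auto
  moreover have "dim = card B"
    using dim_basis[OF _ basis] finB card_image[OF inj] by simp
  ultimately show ?thesis using inj by blast
qed

end

lemma coordinates_subspace: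
  assumes "coordinates V \<phi>" and "U \<subseteq> carrier V" and "\<zero>\<^bsub>V\<^esub> \<in> U"
    and "\<And>x y. x \<in> U \<Longrightarrow> y \<in> U \<Longrightarrow> x \<oplus>\<^bsub>V\<^esub> y \<in> U"
    and "\<And>c x. x \<in> U \<Longrightarrow> c \<odot>\<^bsub>V\<^esub> x \<in> U"
  shows "coordinates (V\<lparr>carrier := U\<rparr>) \<phi>"
proof -
  interpret coordinates V \<phi> by fact
  show ?thesis using assms(2-) by unfold_locales (auto simp: subset_iff intro: coord_inj)
qed

lemma coordinates_free_tensor:
  assumes "coordinates V \<phi>"
  shows "coordinates (free_tensor B V) (\<lambda>\<omega> (b, c). \<phi> (\<omega> b) c)"
proof -
  interpret coordinates V \<phi> by fact
  have [simp]: "\<zero>\<^bsub>V\<^esub> \<oplus>\<^bsub>V\<^esub> \<zero>\<^bsub>V\<^esub> = \<zero>\<^bsub>V\<^esub>" "c \<odot>\<^bsub>V\<^esub> \<zero>\<^bsub>V\<^esub> = \<zero>\<^bsub>V\<^esub>" for c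
    by (auto intro!: coord_inj)
  have carrier: "f \<in> carrier (free_tensor B V) \<longleftrightarrow> (\<forall>b. f b \<in> carrier V) \<and>
      finite {b. f b \<noteq> \<zero>\<^bsub>V\<^esub>} \<and> (\<forall>b. b \<notin> B \<longrightarrow> f b = \<zero>\<^bsub>V\<^esub>)" for f
    by (simp add: free_tensor_def)
  have ops: "\<zero>\<^bsub>free_tensor B V\<^esub> = (\<lambda>b. \<zero>\<^bsub>V\<^esub>)"
    "f \<oplus>\<^bsub>free_tensor B V\<^esub> g = (\<lambda>b. f b \<oplus>\<^bsub>V\<^esub> g b)"
    "c \<odot>\<^bsub>free_tensor B V\<^esub> f = (\<lambda>b. c \<odot>\<^bsub>V\<^esub> f b)" for f g c
    by (simp_all add: free_tensor_def)
  show ?thesis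
  proof
    fix x y assume xy: "x \<in> carrier (free_tensor B V)" "y \<in> carrier (free_tensor B V)"
    then have fin: "finite ({b. x b \<noteq> \<zero>\<^bsub>V\<^esub>} \<union> {b. y b \<noteq> \<zero>\<^bsub>V\<^esub>})"
      by (simp add: carrier)
    have "finite {b. x b \<oplus>\<^bsub>V\<^esub> y b \<noteq> \<zero>\<^bsub>V\<^esub>}"
      by (rule finite_subset[OF _ fin]) auto
    then show "x \<oplus>\<^bsub>free_tensor B V\<^esub> y \<in> carrier (free_tensor B V)"
      using xy by (simp add: carrier ops)
  next
    fix x c assume x: "x \<in> carrier (free_tensor B V)"
    then have fin: "finite {b. x b \<noteq> \<zero>\<^bsub>V\<^esub>}" by (simp add: carrier)
    have "finite {b. c \<odot>\<^bsub>V\<^esub> x b \<noteq> \<zero>\<^bsub>V\<^esub>}"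
      by (rule finite_subset[OF _ fin]) auto
    then show "c \<odot>\<^bsub>free_tensor B V\<^esub> x \<in> carrier (free_tensor B V)"
      using x by (simp add: carrier ops)
  next
    fix x y assume xy: "x \<in> carrier (free_tensor B V)" "y \<in> carrier (free_tensor B V)"
      and eq: "\<And>b. (case b of (b, c) \<Rightarrow> \<phi> (x b) c) = (case b of (b, c) \<Rightarrow> \<phi> (y b) c)"
    have "x b = y b" for b
    proof (rule coord_inj)
      show "\<phi> (x b) c = \<phi> (y b) c" for c using eq[of "(b, c)"] by simp
    qed (use xy in \<open>simp_all add: carrier\<close>)
    then show "x = y" ..
  qed (simp_all add: carrier ops split: prod.split)
qed

text \<open>If \<open>N\<close> is the kernel of a linear map \<open>\<psi>\<close>, the cosets of
  \<open>N\<close> are the nonempty fibres of \<open>\<psi>\<close>, so \<open>\<psi>\<close>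
  descends to an injective linear map on the quotient.\<close>

locale quotient_coordinates = coordinates V \<phi>
  for V :: "('k::field, 'v) module" and \<phi> :: "'v \<Rightarrow> 'b \<Rightarrow> 'k" +
  fixes N :: "'v set" and \<psi> :: "'v \<Rightarrow> 'c \<Rightarrow> 'k"
  assumes lin_add [simp]:
      "x \<in> carrier V \<Longrightarrow> y \<in> carrier V \<Longrightarrow> \<psi> (x \<oplus>\<^bsub>V\<^esub> y) b = \<psi> x b + \<psi> y b"
    and lin_smult [simp]: "x \<in> carrier V \<Longrightarrow> \<psi> (c \<odot>\<^bsub>V\<^esub> x) b = c * \<psi> x b"
    and kernel: "N = {x \<in> carrier V. \<forall>b. \<psi> x b = 0}"
begin

abbreviation coset where "coset x \<equiv> N +>\<^bsub>V\<^esub> x"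

text \<open>The choice of representative is harmless because \<open>\<psi>\<close> is constant on
  each coset.\<close>

definition qcoord :: "'v set \<Rightarrow> 'c \<Rightarrow> 'k" where
  "qcoord X = \<psi> (SOME x. x \<in> X)"

lemma coset_eq_fibre:
  assumes x: "x \<in> carrier V"
  shows "coset x = {y \<in> carrier V. \<psi> y = \<psi> x}"
proof -
  have "y \<in> coset x" if y: "y \<in> carrier V" "\<psi> y = \<psi> x" for y
  proof -
    \<comment> \<open>Differences are written with the scalar \<open>- 1\<close>, since the axioms
      of \<open>coordinates\<close> speak only of sums and scalar multiples.\<close>
    let ?h = "y \<oplus>\<^bsub>V\<^esub> (- 1) \<odot>\<^bsub>V\<^esub> x"
    have "?h \<in> N" using x y by (auto simp: kernel)
    moreover have "y = ?h \<oplus>\<^bsub>V\<^esub> x" using x y by (intro coord_inj) auto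
    ultimately show ?thesis by (auto simp: a_r_coset_def')
  qed
  then show ?thesis using x by (auto simp: a_r_coset_def' kernel)
qed

lemma self_in_coset: "x \<in> carrier V \<Longrightarrow> x \<in> coset x"
  by (simp add: coset_eq_fibre)

lemma qcoord_coset [simp]: "x \<in> carrier V \<Longrightarrow> qcoord (coset x) = \<psi> x"
  unfolding qcoord_def using someI[of "\<lambda>y. y \<in> coset x" x] by (auto simp: coset_eq_fibre)

lemma coset_eq_iff:
  "x \<in> carrier V \<Longrightarrow> y \<in> carrier V \<Longrightarrow> coset x = coset y \<longleftrightarrow> \<psi> x = \<psi> y"
  by (auto simp: coset_eq_fibre)

lemma lin_zero [simp]: "\<psi> \<zero>\<^bsub>V\<^esub> b = 0"
proof -
  have "0 \<odot>\<^bsub>V\<^esub> \<zero>\<^bsub>V\<^esub> = \<zero>\<^bsub>V\<^esub>" by (intro coord_inj) auto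
  then show ?thesis using lin_smult[of "\<zero>\<^bsub>V\<^esub>" 0 b] by simp
qed

lemma coset_zero: "coset \<zero>\<^bsub>V\<^esub> = N"
  by (simp add: coset_eq_fibre fun_eq_iff) (simp add: kernel)

lemma carrier_quot: "carrier (quot_module V N) = coset ` carrier V"
  by (auto simp: quot_module_def ring.defs module.defs FactRing_def A_RCOSETS_def' a_r_coset_def')

lemma zero_quot: "\<zero>\<^bsub>quot_module V N\<^esub> = coset \<zero>\<^bsub>V\<^esub>"
  by (simp add: quot_module_def ring.defs module.defs FactRing_def coset_zero)

lemma add_quot:
  assumes "x \<in> carrier V" "y \<in> carrier V"
  shows "coset x \<oplus>\<^bsub>quot_module V N\<^esub> coset y = coset (x \<oplus>\<^bsub>V\<^esub> y)"
proof -
  have "coset x <+>\<^bsub>V\<^esub> coset y = coset (x \<oplus>\<^bsub>V\<^esub> y)"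
  proof
    show "coset x <+>\<^bsub>V\<^esub> coset y \<subseteq> coset (x \<oplus>\<^bsub>V\<^esub> y)"
      using assms by (auto simp: set_add_def' coset_eq_fibre)
    show "coset (x \<oplus>\<^bsub>V\<^esub> y) \<subseteq> coset x <+>\<^bsub>V\<^esub> coset y"
    proof
      fix z assume z: "z \<in> coset (x \<oplus>\<^bsub>V\<^esub> y)"
      let ?u = "z \<oplus>\<^bsub>V\<^esub> (- 1) \<odot>\<^bsub>V\<^esub> y"
      have "?u \<in> coset x" "y \<in> coset y" "z = ?u \<oplus>\<^bsub>V\<^esub> y"
        using assms z by (auto simp: coset_eq_fibre intro!: coord_inj)
      then show "z \<in> coset x <+>\<^bsub>V\<^esub> coset y" by (auto simp: set_add_def')
    qed
  qed
  then show ?thesis by (simp add: quot_module_def ring.defs module.defs FactRing_def)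
qed

text \<open>In \<open>quot_module\<close> the scalar multiple is a union over all representatives;
  it collapses because they all yield the same coset.\<close>

lemma smult_quot:
  assumes "x \<in> carrier V"
  shows "c \<odot>\<^bsub>quot_module V N\<^esub> coset x = coset (c \<odot>\<^bsub>V\<^esub> x)"
proof -
  have "coset (c \<odot>\<^bsub>V\<^esub> y) = coset (c \<odot>\<^bsub>V\<^esub> x)" if "y \<in> coset x" for y
    using assms that by (subst coset_eq_iff) (auto simp: coset_eq_fibre)
  then have "(\<Union>y\<in>coset x. coset (c \<odot>\<^bsub>V\<^esub> y)) = coset (c \<odot>\<^bsub>V\<^esub> x)"
    using self_in_coset[OF assms] by blast
  then show ?thesis by (simp add: quot_module_def ring.defs module.defs)
qed

lemma coordinates_quot: "coordinates (quot_module V N) qcoord"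
proof
  fix X Y assume "X \<in> carrier (quot_module V N)" "Y \<in> carrier (quot_module V N)"
    and *: "\<And>b. qcoord X b = qcoord Y b"
  then obtain x y where "x \<in> carrier V" "X = coset x" "y \<in> carrier V" "Y = coset y"
    by (auto simp: carrier_quot)
  with * show "X = Y" by (simp add: coset_eq_iff fun_eq_iff)
qed (auto simp: carrier_quot zero_quot add_quot smult_quot)

end

section \<open>A basis of the quantum exterior algebra\<close>

text \<open>The relation \<open>dx_j dx_i = - inverse q * dx_i dx_j\<close> for \<open>i < j\<close>
  costs one factor per smaller generator passed; this is the total cost of sorting
  \<open>dx_j\<close> into the monomial of \<open>S\<close>.\<close>

definition wsign :: "'k::field \<Rightarrow> 'n::linorder \<Rightarrow> 'n set \<Rightarrow> 'k" where
  "wsign q j S = (- inverse q) ^ card {i \<in> S. i < j}"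

text \<open>Left multiplication by \<open>dx\<^sub>j\<close> in the basis of increasing monomials, which are indexed by sets.\<close>

definition lmul :: "'k::field \<Rightarrow> 'n::linorder \<Rightarrow> ('n set \<Rightarrow> 'k) \<Rightarrow> 'n set \<Rightarrow> 'k" where
  "lmul q j c S = (if j \<in> S then wsign q j S * c (S - {j}) else 0)"

definition word_op :: "'k::field \<Rightarrow> 'n::linorder free_word \<Rightarrow> ('n set \<Rightarrow> 'k) \<Rightarrow> 'n set \<Rightarrow> 'k" where
  "word_op q w = foldr (lmul q) (letters w)"

definition alg_op ::
    "'k::field \<Rightarrow> ('n::linorder free_word \<Rightarrow>\<^sub>0 'k) \<Rightarrow> ('n set \<Rightarrow> 'k) \<Rightarrow> 'n set \<Rightarrow> 'k" where
  "alg_op q f c S = (\<Sum>w\<in>Poly_Mapping.keys f. Poly_Mapping.lookup f w * word_op q w c S)"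

definition unit_coord :: "'n set \<Rightarrow> 'n set \<Rightarrow> 'k::field" where
  "unit_coord T S = (if S = T then 1 else 0)"

text \<open>The unit vector of the empty set stands for the element 1, so acting on it with
  \<open>f\<close> yields the coefficients of the class of \<open>f\<close> on the increasing
  monomials.\<close>

definition wcoord :: "'k::field \<Rightarrow> ('n::linorder free_word \<Rightarrow>\<^sub>0 'k) \<Rightarrow> 'n set \<Rightarrow> 'k" where
  "wcoord q f = alg_op q f (unit_coord {})"

lemma poly_mapping_add_induct [case_names zero add single]:
  fixes f :: "'a \<Rightarrow>\<^sub>0 'b::comm_monoid_add"
  assumes "P 0" and add: "\<And>f g. P f \<Longrightarrow> P g \<Longrightarrow> P (f + g)"
    and single: "\<And>w a. P (Poly_Mapping.single w a)"
  shows "P f"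
proof (induction f rule: update_induct)
  case (update f a b)
  have "Poly_Mapping.update a b f = f + Poly_Mapping.single a b"
    using update by (intro poly_mapping_eqI)
      (auto simp: Poly_Mapping.update.rep_eq lookup_add lookup_single in_keys_iff when_def)
  then show ?case using add single update by simp
qed fact

lemma lmul_add: "lmul q j (\<lambda>S. c S + d S) = (\<lambda>S. lmul q j c S + lmul q j d S)"
  by (auto simp: lmul_def algebra_simps)

lemma lmul_scale: "lmul q j (\<lambda>S. a * c S) = (\<lambda>S. a * lmul q j c S)"
  by (auto simp: lmul_def)

lemma word_op_add: "word_op q w (\<lambda>S. c S + d S) = (\<lambda>S. word_op q w c S + word_op q w d S)"
proof -
  have "foldr (lmul q) xs (\<lambda>S. c S + d S) = (\<lambda>S. foldr (lmul q) xs c S + foldr (lmul q) xs d S)"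
    for xs by (induction xs) (simp_all add: lmul_add)
  then show ?thesis by (simp add: word_op_def)
qed

lemma word_op_scale: "word_op q w (\<lambda>S. a * c S) = (\<lambda>S. a * word_op q w c S)"
proof -
  have "foldr (lmul q) xs (\<lambda>S. a * c S) = (\<lambda>S. a * foldr (lmul q) xs c S)" for xs
    by (induction xs) (simp_all add: lmul_scale)
  then show ?thesis by (simp add: word_op_def)
qed

lemma alg_op_add: "alg_op q (f + g) c = (\<lambda>S. alg_op q f c S + alg_op q g c S)"
  unfolding alg_op_def
  by (intro ext setsum_keys_plus_distrib[where f = "\<lambda>w a. a * word_op q w c _"])
    (simp_all add: algebra_simps)

lemma alg_op_single: "alg_op q (Poly_Mapping.single w a) c = (\<lambda>S. a * word_op q w c S)"
  by (simp add: alg_op_def fun_eq_iff)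

lemma alg_op_zero [simp]: "alg_op q 0 c = (\<lambda>S. 0)"
  by (simp add: alg_op_def fun_eq_iff)

text \<open>Additivity in both factors reduces the claim to two single words, where concatenation of
  words is composition of folds.\<close>

lemma alg_op_mult: "alg_op q (f * g) c = alg_op q f (alg_op q g c)"
proof (induction f rule: poly_mapping_add_induct)
  case (single v a)
  show ?case
  proof (induction g rule: poly_mapping_add_induct)
    case zero
    show ?case using word_op_scale[of q v 0 "\<lambda>_. 0"] by (simp add: alg_op_single)
  next
    case (add g h)
    then show ?case
      by (simp add: distrib_left alg_op_add alg_op_single word_op_add)
  next
    case (single w b)
    show ?case
      by (simp add: mult_single alg_op_single word_op_scale mult.assoc)
        (simp add: word_op_def plus_free_word_def)
  qed
qed (simp_all add: alg_op_add distrib_right)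

lemma alg_op_scalar: "alg_op q (scalar a) c = (\<lambda>S. a * c S)"
  by (simp add: scalar_def alg_op_single word_op_def zero_free_word_def)

lemma alg_op_gen: "alg_op q (gen j) c = lmul q j c"
  by (simp add: gen_def alg_op_single word_op_def)

lemma lmul_square: "lmul q j (lmul q j c) = (\<lambda>S. 0)"
  by (auto simp: lmul_def)

lemma wsign_Diff_less:
  fixes S :: "'n::{finite,linorder} set"
  shows "i < j \<Longrightarrow> i \<in> S \<Longrightarrow> wsign q j S = - inverse q * wsign q j (S - {i})"
proof -
  assume "i < j" "i \<in> S"
  then have "{t \<in> S. t < j} = insert i {t \<in> S - {i}. t < j}" by auto
  then have "card {t \<in> S. t < j} = Suc (card {t \<in> S - {i}. t < j})"
    by (metis (no_types, lifting) DiffE card_insert_disjoint finite insertCI mem_Collect_eq)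
  then show ?thesis by (simp add: wsign_def)
qed

lemma wsign_Diff_ge: "i \<ge> j \<Longrightarrow> wsign q j (S - {i}) = wsign q j S"
  unfolding wsign_def by (rule arg_cong[of _ _ "\<lambda>A. _ ^ card A"]) auto

lemma wsign_insert_self: "wsign q j (insert j S) = wsign q j S"
  unfolding wsign_def by (rule arg_cong[of _ _ "\<lambda>A. _ ^ card A"]) auto

text \<open>Deleting the smaller index \<open>i\<close> changes the exponent in the sign of
  \<open>j\<close> by one, while deleting \<open>j\<close> leaves the sign of \<open>i\<close>
  alone. With \<open>lmul_square\<close> this shows that the operators obey the defining
  relations.\<close>

lemma lmul_anticommute:
  fixes i j :: "'n::{finite,linorder}"
  assumes "i < j"
  shows "lmul q j (lmul q i c) S = - inverse q * lmul q i (lmul q j c) S"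
  using assms wsign_Diff_less[OF assms, of S q] wsign_Diff_ge[of i j q S]
  by (auto simp: lmul_def insert_commute Diff_insert[symmetric] algebra_simps)

section \<open>The ideal of relations and its action\<close>

lemma ring_free_algebra:
  "ring (free_algebra :: ('k::field, 'n free_word \<Rightarrow>\<^sub>0 'k) module)"
proof (rule ringI)
  show "abelian_group (free_algebra :: ('k::field, 'n free_word \<Rightarrow>\<^sub>0 'k) module)"
  proof (rule abelian_groupI)
    fix x assume "x \<in> carrier (free_algebra :: ('k::field, 'n free_word \<Rightarrow>\<^sub>0 'k) module)"
    show "\<exists>y\<in>carrier free_algebra. y \<oplus>\<^bsub>free_algebra\<^esub> x = \<zero>\<^bsub>free_algebra :: ('k, 'n free_word \<Rightarrow>\<^sub>0 'k) module\<^esub>"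
      by (rule bexI[of _ "- x"]) (auto simp: free_algebra_def)
  qed (auto simp: free_algebra_def algebra_simps)
  show "monoid (free_algebra :: ('k::field, 'n free_word \<Rightarrow>\<^sub>0 'k) module)"
    by (rule monoidI) (auto simp: free_algebra_def algebra_simps)
qed (auto simp: free_algebra_def algebra_simps)

lemma ideal_wedge_ideal: "ideal (wedge_ideal q) free_algebra"
  unfolding wedge_ideal_def
  by (rule ring.genideal_ideal[OF ring_free_algebra]) (simp add: free_algebra_def)

lemma wedge_rels_subset: "wedge_rels q \<subseteq> wedge_ideal q"
  unfolding wedge_ideal_def
  by (rule ring.genideal_self[OF ring_free_algebra]) (simp add: free_algebra_def)

lemma wedge_ideal_zero: "0 \<in> wedge_ideal q"
  using additive_subgroup.zero_closed[OF ideal.axioms(1)[OF ideal_wedge_ideal[of q]]]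
  by (simp add: free_algebra_def)

lemma wedge_ideal_add: "f \<in> wedge_ideal q \<Longrightarrow> g \<in> wedge_ideal q \<Longrightarrow> f + g \<in> wedge_ideal q"
  using additive_subgroup.a_closed[OF ideal.axioms(1)[OF ideal_wedge_ideal[of q]]]
  by (simp add: free_algebra_def)

lemma wedge_ideal_lmult: "f \<in> wedge_ideal q \<Longrightarrow> g * f \<in> wedge_ideal q"
  using ideal.I_l_closed[OF ideal_wedge_ideal[of q]] by (simp add: free_algebra_def)

lemma wedge_ideal_rmult: "f \<in> wedge_ideal q \<Longrightarrow> f * g \<in> wedge_ideal q"
  using ideal.I_r_closed[OF ideal_wedge_ideal[of q]] by (simp add: free_algebra_def)

lemma wedge_ideal_sum: "(\<And>a. a \<in> A \<Longrightarrow> f a \<in> wedge_ideal q) \<Longrightarrow> sum f A \<in> wedge_ideal q"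
  by (induction A rule: infinite_finite_induct) (auto simp: wedge_ideal_zero wedge_ideal_add)

text \<open>The elements that act as zero form a two-sided ideal containing the relations, hence
  containing the ideal generated by them. This is what keeps the increasing monomials independent in
  the quotient.\<close>

lemma wedge_ideal_acts_zero:
  fixes f :: "'n::{finite,linorder} free_word \<Rightarrow>\<^sub>0 'k::field"
  assumes "f \<in> wedge_ideal q"
  shows "alg_op q f c = (\<lambda>S. 0)"
proof -
  \<comment> \<open>Quantifying over all vectors \<open>c\<close> makes \<open>J\<close> closed
    under multiplication from the right: \<open>f * g\<close> acts on \<open>c\<close> as
    \<open>f\<close> acts on the image of \<open>c\<close> under \<open>g\<close>.\<close>
  define J where "J = {f :: 'n free_word \<Rightarrow>\<^sub>0 'k. \<forall>c. alg_op q f c = (\<lambda>S. 0)}"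
  have zero: "alg_op q f (\<lambda>S. 0) = (\<lambda>S. 0)" for f :: "'n free_word \<Rightarrow>\<^sub>0 'k"
    using alg_op_mult[of q f 0] by simp
  have neg: "alg_op q (- f) c = (\<lambda>S. - alg_op q f c S)" for f :: "'n free_word \<Rightarrow>\<^sub>0 'k" and c
    using alg_op_add[of q f "- f" c] by (auto simp: fun_eq_iff eq_neg_iff_add_eq_0 add.commute)
  have "ideal J free_algebra"
  proof (rule idealI[OF ring_free_algebra])
    interpret abelian_group "free_algebra :: ('k, 'n free_word \<Rightarrow>\<^sub>0 'k) module"
      by (rule ring.is_abelian_group[OF ring_free_algebra])
    show "subgroup J (add_monoid free_algebra)"
    proof (rule add.subgroupI)
      fix f assume f: "f \<in> J"
      have "\<ominus>\<^bsub>free_algebra\<^esub> f = - f"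
        by (rule minus_equality) (simp_all add: free_algebra_def)
      then show "\<ominus>\<^bsub>free_algebra\<^esub> f \<in> J" using f by (simp add: J_def neg)
    qed (auto simp: J_def free_algebra_def alg_op_add intro: exI[of _ 0])
  qed (auto simp: J_def free_algebra_def alg_op_mult zero)
  moreover have "wedge_rels q \<subseteq> J"
    by (auto simp: wedge_rels_def J_def alg_op_add alg_op_mult alg_op_gen alg_op_scalar
        lmul_square lmul_anticommute)
  ultimately have "wedge_ideal q \<subseteq> J"
    unfolding wedge_ideal_def by (rule ring.genideal_minimal[OF ring_free_algebra])
  then show ?thesis using assms by (auto simp: J_def)
qed

lemma scalar_commute: "f * scalar a = scalar a * f"
  by (induction f rule: poly_mapping_add_induct)
    (simp_all add: algebra_simps scalar_def mult_single)

lemma scalar_left_commute: "f * (scalar a * g) = scalar a * (f * g)"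
  by (metis mult.assoc scalar_commute)

lemma scalar_mult: "scalar (a * b) = scalar a * scalar b"
  by (simp add: scalar_def mult_single)

lemma scalar_add: "scalar (a + b) = scalar a + scalar b"
  by (simp add: scalar_def single_add)

lemma scalar_zero [simp]: "scalar 0 = 0"
  by (simp add: scalar_def)

lemma scalar_one [simp]: "scalar 1 = 1"
  by (simp add: scalar_def)

section \<open>Sorting words modulo the relations\<close>

definition word_elem :: "'n list \<Rightarrow> 'n free_word \<Rightarrow>\<^sub>0 'k::field" where
  "word_elem xs = Poly_Mapping.single (Free_Word xs) 1"

lemma word_elem_Cons: "word_elem (x # xs) = gen x * word_elem xs"
  by (simp add: word_elem_def gen_def mult_single plus_free_word_def)

lemma word_elem_Nil: "word_elem [] = 1"
  by (simp add: word_elem_def zero_free_word_def[symmetric])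

lemma sorted_list_of_set_insert_less:
  assumes "finite S" "\<And>x. x \<in> S \<Longrightarrow> a < x"
  shows "sorted_list_of_set (insert a S) = a # sorted_list_of_set S"
proof -
  have "S - {a} = S" using assms(2) by blast
  then show ?thesis using assms by (simp add: insort_is_Cons less_imp_le)
qed

text \<open>The letter \<open>j\<close> is moved rightwards past the smaller letters of the sorted
  word until it finds its place or meets its equal, where the product dies. The result matches the
  action of \<open>lmul q j\<close> on a basis vector.\<close>

lemma gen_word_elem_reduce:
  fixes xs :: "'n::{finite,linorder} list"
  assumes "sorted_wrt (<) xs"
  shows "gen j * word_elem xs - (if j \<in> set xs then 0 else
      scalar (wsign q j (set xs)) * word_elem (sorted_list_of_set (insert j (set xs)))) \<in> wedge_ideal q"
  using assms
proof (induction xs)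
  case Nil
  show ?case by (simp add: word_elem_Cons word_elem_Nil wsign_def wedge_ideal_zero)
next
  case (Cons a xs)
  have xs: "sorted_list_of_set (set xs) = xs"
    using Cons.prems by (simp add: sorted_list_of_set.idem_if_sorted_distinct strict_sorted_iff)
  consider "j < a" | "j = a" | "a < j" by fastforce
  then show ?case
  proof cases
    case 1
    have "sorted_list_of_set (insert j (set (a # xs))) = j # a # xs"
    proof (subst sorted_list_of_set_insert_less)
      show "j # sorted_list_of_set (set (a # xs)) = j # a # xs"
        using Cons.prems by (simp only: sorted_list_of_set.idem_if_sorted_distinct strict_sorted_iff)
    qed (use 1 Cons.prems in auto)
    moreover have "{i \<in> set (a # xs). i < j} = {}" using 1 Cons.prems by auto
    moreover have "j \<notin> set (a # xs)" using 1 Cons.prems by auto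
    ultimately show ?thesis
      by (simp only: wsign_def word_elem_Cons) (simp add: wedge_ideal_zero)
  next
    case 2
    have "gen a * gen a \<in> wedge_ideal q"
      using wedge_rels_subset by (auto simp: wedge_rels_def)
    then show ?thesis
      using 2 wedge_ideal_rmult by (simp add: word_elem_Cons mult.assoc[symmetric])
  next
    case 3
    let ?r = "gen j * gen a + scalar (inverse q) * (gen a * gen j)"
    \<comment> \<open>\<open>t\<close> is the sorted form of \<open>gen j\<close> times the
      tail.\<close>
    define t where "t = (if j \<in> set xs then 0 else
      scalar (wsign q j (set xs)) * word_elem (sorted_list_of_set (insert j (set xs))))"
    have r: "?r \<in> wedge_ideal q"
      using 3 wedge_rels_subset[of q] by (auto simp: wedge_rels_def)
    have IH: "gen j * word_elem xs - t \<in> wedge_ideal q"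
      using Cons unfolding t_def by simp
    have "(if j \<in> set (a # xs) then 0 else scalar (wsign q j (set (a # xs))) *
        word_elem (sorted_list_of_set (insert j (set (a # xs))))) = scalar (- inverse q) * gen a * t"
    proof (cases "j \<in> set xs")
      case False
      have "sorted_list_of_set (insert j (set (a # xs))) = a # sorted_list_of_set (insert j (set xs))"
        using 3 Cons.prems by (simp only: list.set insert_commute[of j a])
          (subst sorted_list_of_set_insert_less; auto)
      moreover have "wsign q j (set (a # xs)) = - inverse q * wsign q j (set xs)"
        using wsign_Diff_less[OF 3, of "set (a # xs)"] Cons.prems
        by (subst (asm) Diff_insert_absorb[of a "set xs", folded list.set(2)]) auto
      moreover have "j \<notin> set (a # xs)" using False 3 by auto
      ultimately show ?thesis
        using False by (simp only: t_def if_False word_elem_Cons scalar_mult mult.assoc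
          scalar_left_commute[of "gen a"])
    qed (simp add: t_def)
    \<comment> \<open>The relation \<open>?r\<close> swaps \<open>gen j\<close> with the head
      \<open>a\<close>; the induction hypothesis then sorts \<open>gen j\<close> into the tail
      behind \<open>gen a\<close>.\<close>
    moreover have "gen j * word_elem (a # xs) - scalar (- inverse q) * gen a * t
        = ?r * word_elem xs + scalar (- inverse q) * gen a * (gen j * word_elem xs - t)"
      by (simp add: word_elem_Cons algebra_simps scalar_def single_uminus)
    moreover have "?r * word_elem xs + scalar (- inverse q) * gen a * (gen j * word_elem xs - t)
        \<in> wedge_ideal q"
      by (intro wedge_ideal_add wedge_ideal_rmult[OF r] wedge_ideal_lmult IH)
    ultimately show ?thesis by simp
  qed
qed


definition normal_form :: "('n::{finite,linorder} set \<Rightarrow> 'k::field) \<Rightarrow> 'n free_word \<Rightarrow>\<^sub>0 'k" where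
  "normal_form c = (\<Sum>S\<in>UNIV. scalar (c S) * word_elem (sorted_list_of_set S))"

lemma wcoord_gen_mult: "wcoord q (gen j * f) = lmul q j (wcoord q f)"
  by (simp add: wcoord_def alg_op_mult alg_op_gen)

lemma wcoord_add: "wcoord q (f + g) S = wcoord q f S + wcoord q g S"
  by (simp add: wcoord_def alg_op_add)

lemma wcoord_scalar_mult: "wcoord q (scalar a * f) S = a * wcoord q f S"
  by (simp add: wcoord_def alg_op_mult alg_op_scalar)

lemma wcoord_one: "wcoord q 1 = unit_coord {}"
  using alg_op_scalar[of q 1 "unit_coord {}"] by (simp add: wcoord_def)

lemma normal_form_add: "normal_form (\<lambda>S. c S + d S) = normal_form c + normal_form d"
  by (simp add: normal_form_def scalar_add algebra_simps sum.distrib)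

lemma normal_form_scale: "normal_form (\<lambda>S. a * c S) = scalar a * normal_form c"
  by (simp add: normal_form_def scalar_mult sum_distrib_left mult.assoc)

lemma normal_form_zero: "normal_form (\<lambda>S. 0) = 0"
  by (simp add: normal_form_def)

text \<open>This sums \<open>gen_word_elem_reduce\<close> over all monomials: modulo the ideal, left
  multiplication by a generator is \<open>lmul\<close> on coefficients.\<close>

lemma normal_form_lmul:
  fixes j :: "'n::{finite,linorder}"
  shows "gen j * normal_form c - normal_form (lmul q j c) \<in> wedge_ideal q"
proof -
  let ?w = "\<lambda>S. word_elem (sorted_list_of_set S) :: 'n free_word \<Rightarrow>\<^sub>0 'a"
  let ?t = "\<lambda>S. if j \<in> S then 0 else scalar (wsign q j S) * ?w (insert j S)"
  \<comment> \<open>Only sets containing \<open>j\<close> carry a coefficient of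
    \<open>lmul q j c\<close>; inserting \<open>j\<close> matches them with the sets that lack
    it.\<close>
  have img: "insert j ` {S. j \<notin> S} = {T. j \<in> T}"
  proof (rule equalityI; rule subsetI)
    fix T assume "T \<in> {T. j \<in> T}"
    then show "T \<in> insert j ` {S. j \<notin> S}" by (intro image_eqI[of _ _ "T - {j}"]) auto
  qed auto
  have "normal_form (lmul q j c)
      = (\<Sum>T\<in>insert j ` {S. j \<notin> S}. scalar (lmul q j c T) * ?w T)"
    unfolding normal_form_def img by (rule sum.mono_neutral_right) (auto simp: lmul_def)
  also have "\<dots> = (\<Sum>S | j \<notin> S. scalar (lmul q j c (insert j S)) * ?w (insert j S))"
    by (rule sum.reindex[unfolded o_def]) (auto simp: inj_on_def)
  also have "\<dots> = (\<Sum>S | j \<notin> S. scalar (c S) * ?t S)"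
    by (intro sum.cong)
      (simp_all add: lmul_def wsign_insert_self scalar_mult[symmetric] mult.assoc[symmetric] mult.commute)
  also have "\<dots> = (\<Sum>S\<in>UNIV. scalar (c S) * ?t S)"
    by (rule sum.mono_neutral_left) auto
  finally have "gen j * normal_form c - normal_form (lmul q j c)
      = (\<Sum>S\<in>UNIV. scalar (c S) * (gen j * ?w S - ?t S))"
    by (simp add: normal_form_def sum_distrib_left right_diff_distrib sum_subtractf
        scalar_left_commute[of "gen j"])
  moreover have "scalar (c S) * (gen j * ?w S - ?t S) \<in> wedge_ideal q" for S
  proof (rule wedge_ideal_lmult)
    have "sorted_wrt (<) (sorted_list_of_set S)" "set (sorted_list_of_set S) = S" by simp_all
    then show "gen j * ?w S - ?t S \<in> wedge_ideal q"
      using gen_word_elem_reduce[of "sorted_list_of_set S" j q] by metis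
  qed
  ultimately show ?thesis by (simp only: wedge_ideal_sum)
qed

text \<open>The spanning half of the basis statement: by linearity it suffices to treat words, and
  these are built up one letter at a time from the left.\<close>

lemma minus_normal_form_in_wedge_ideal:
  fixes f :: "'n::{finite,linorder} free_word \<Rightarrow>\<^sub>0 'k::field"
  shows "f - normal_form (wcoord q f) \<in> wedge_ideal q"
proof (induction f rule: poly_mapping_add_induct)
  case zero
  then show ?case by (simp add: wcoord_def normal_form_zero wedge_ideal_zero)
next
  case (add f g)
  have "wcoord q (f + g) = (\<lambda>S. wcoord q f S + wcoord q g S)"
    by (simp add: fun_eq_iff wcoord_add)
  with wedge_ideal_add[OF add] show ?case by (simp add: normal_form_add algebra_simps)
next
  case (single w a)
  have word: "word_elem xs - normal_form (wcoord q (word_elem xs)) \<in> wedge_ideal q" for xs :: "'n list"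
  proof (induction xs)
    case Nil
    have "normal_form (unit_coord {} :: 'n set \<Rightarrow> 'k) = (\<Sum>S\<in>{{}}. scalar (unit_coord {} S) * word_elem (sorted_list_of_set S))"
      unfolding normal_form_def by (rule sum.mono_neutral_right) (auto simp: unit_coord_def)
    also have "\<dots> = 1" by (simp add: unit_coord_def word_elem_Nil)
    finally show ?case by (simp add: word_elem_Nil wcoord_one wedge_ideal_zero)
  next
    case (Cons x xs)
    from wedge_ideal_add[OF wedge_ideal_lmult[OF Cons, of "gen x"] normal_form_lmul[of x "wcoord q (word_elem xs)" q]]
    show ?case by (simp add: word_elem_Cons wcoord_gen_mult algebra_simps)
  qed
  have w: "Poly_Mapping.single w a = scalar a * word_elem (letters w)"
    by (simp add: scalar_def word_elem_def mult_single)
  have "wcoord q (scalar a * word_elem (letters w)) = (\<lambda>S. a * wcoord q (word_elem (letters w)) S)"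
    by (simp add: fun_eq_iff wcoord_scalar_mult)
  with wedge_ideal_lmult[OF word[of "letters w"], of "scalar a"] show ?case
    by (simp add: w normal_form_scale right_diff_distrib)
qed

lemma wedge_ideal_eq_kernel:
  "wedge_ideal q = {f :: 'n::{finite,linorder} free_word \<Rightarrow>\<^sub>0 'k::field. \<forall>S. wcoord q f S = 0}"
proof (rule equalityI; rule subsetI)
  fix f :: "'n free_word \<Rightarrow>\<^sub>0 'k" assume "f \<in> {f. \<forall>S. wcoord q f S = 0}"
  then have "wcoord q f = (\<lambda>S. 0)" by auto
  then show "f \<in> wedge_ideal q"
    using minus_normal_form_in_wedge_ideal[of f q] by (simp add: normal_form_zero)
qed (simp add: wcoord_def wedge_ideal_acts_zero)

section \<open>Coordinates on the exterior algebra and on its homogeneous parts\<close>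

lemma lookup_scalar_mult: "Poly_Mapping.lookup (scalar a * f) w = a * Poly_Mapping.lookup f w"
  by (induction f rule: poly_mapping_add_induct)
    (simp_all add: scalar_def distrib_left lookup_add mult_single lookup_single when_def)

interpretation wedge: quotient_coordinates free_algebra Poly_Mapping.lookup "wedge_ideal q" "wcoord q"
  for q :: "'k::field"
proof
  fix f g :: "'n free_word \<Rightarrow>\<^sub>0 'k"
  assume "\<And>b. Poly_Mapping.lookup f b = Poly_Mapping.lookup g b"
  then show "f = g" by (rule poly_mapping_eqI)
qed (auto simp: free_algebra_def lookup_add lookup_scalar_mult wcoord_add wcoord_scalar_mult
    wedge_ideal_eq_kernel)

lemma in_carrier_free_algebra [simp]: "f \<in> carrier free_algebra"
  by (simp add: free_algebra_def)

text \<open>Each letter is smaller than all letters after it, so no transposition occurs and every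
  sign is 1.\<close>

lemma wcoord_word_elem:
  assumes "sorted_wrt (<) xs"
  shows "wcoord q (word_elem xs) = unit_coord (set xs)"
  using assms
proof (induction xs)
  case Nil
  then show ?case by (simp add: word_elem_Nil wcoord_one)
next
  case (Cons x xs)
  have "lmul q x (unit_coord (set xs)) S = unit_coord (set (x # xs)) S" for S
  proof (cases "S = set (x # xs)")
    case True
    have *: "{i \<in> set (x # xs). i < x} = {}" "set (x # xs) - {x} = set xs"
      using Cons.prems by auto
    then have "wsign q x (set (x # xs)) = 1" by (simp only: wsign_def card.empty power_0)
    then show ?thesis unfolding True lmul_def * unit_coord_def by simp
  next
    case False
    then show ?thesis by (auto simp: lmul_def unit_coord_def)
  qed
  then have "lmul q x (unit_coord (set xs)) = unit_coord (set (x # xs))" ..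
  moreover have "wcoord q (word_elem xs) = unit_coord (set xs)" using Cons by simp
  ultimately show ?case unfolding word_elem_Cons wcoord_gen_mult by metis
qed

lemma wcoord_sum: "wcoord q (sum f A) S = (\<Sum>a\<in>A. wcoord q (f a) S)"
  by (induction A rule: infinite_finite_induct) (simp_all add: wcoord_add, simp_all add: wcoord_def)

lemma wcoord_normal_form: "wcoord q (normal_form c) = c"
proof
  fix S
  have "wcoord q (normal_form c) S = (\<Sum>T\<in>UNIV. c T * unit_coord T S)"
    by (simp add: normal_form_def wcoord_sum wcoord_scalar_mult wcoord_word_elem)
  also have "\<dots> = (\<Sum>T\<in>UNIV. if S = T then c T else 0)"
    by (rule sum.cong) (auto simp: unit_coord_def)
  finally show "wcoord q (normal_form c) S = c S" by simp
qed

abbreviation wedge_coord :: "'k::field \<Rightarrow> ('n::{finite,linorder} free_word \<Rightarrow>\<^sub>0 'k) set \<Rightarrow> 'n set \<Rightarrow> 'k" where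
  "wedge_coord q \<equiv> wedge.qcoord q"

lemma coordinates_wedge: "coordinates (wedge q) (wedge_coord q)"
  unfolding wedge_def by (rule wedge.coordinates_quot)

lemma carrier_wedge: "carrier (wedge q) = range (\<lambda>f. wedge_ideal q +>\<^bsub>free_algebra\<^esub> f)"
  by (simp add: wedge_def wedge.carrier_quot) (simp add: free_algebra_def)

lemma wedge_mult_coset:
  "(wedge_ideal q +>\<^bsub>free_algebra\<^esub> f) \<otimes>\<^bsub>wedge q\<^esub> (wedge_ideal q +>\<^bsub>free_algebra\<^esub> g)
    = wedge_ideal q +>\<^bsub>free_algebra\<^esub> (f * g)"
  using ideal.rcoset_mult_add[OF ideal_wedge_ideal[of q], of f g]
  by (simp add: wedge_def quot_module_def ring.defs module.defs FactRing_def) (simp add: free_algebra_def)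

lemma dx_mult:
  assumes "X \<in> carrier (wedge q)"
  shows "dx q j \<otimes>\<^bsub>wedge q\<^esub> X \<in> carrier (wedge q)"
    and "wedge_coord q (dx q j \<otimes>\<^bsub>wedge q\<^esub> X) = lmul q j (wedge_coord q X)"
  using assms by (auto simp: carrier_wedge dx_def wedge_mult_coset wcoord_gen_mult)

lemma dx_wedge_coset: "dx_wedge q js = wedge_ideal q +>\<^bsub>free_algebra\<^esub> word_elem js"
proof (induction js)
  case Nil
  then show ?case
    by (simp add: dx_wedge_def word_elem_Nil wedge_def quot_module_def ring.defs module.defs FactRing_def)
      (simp add: free_algebra_def)
next
  case (Cons j js)
  then show ?case
    by (simp add: dx_wedge_def dx_def wedge_mult_coset word_elem_Cons)
qed


text \<open>Each \<open>lmul\<close> adds exactly one element to the supporting sets, starting from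
  the empty set.\<close>

lemma wcoord_support:
  fixes f :: "'n::{finite,linorder} free_word \<Rightarrow>\<^sub>0 'k::field"
  assumes "wcoord q f S \<noteq> 0"
  shows "\<exists>w\<in>Poly_Mapping.keys f. card S = length (letters w)"
proof -
  have *: "foldr (lmul q) xs (unit_coord {}) S \<noteq> 0 \<Longrightarrow> card S = length xs"
    for xs :: "'n list" and S
  proof (induction xs arbitrary: S)
    case (Cons x xs)
    then have "x \<in> S" "foldr (lmul q) xs (unit_coord {}) (S - {x}) \<noteq> 0"
      by (auto simp: lmul_def[of q x "foldr (lmul q) xs (unit_coord {})"] split: if_splits)
    with Cons.IH[of "S - {x}"] show ?case by (metis card_Suc_Diff1 finite length_Cons)
  qed (auto simp: unit_coord_def split: if_splits)
  from assms obtain w where "w \<in> Poly_Mapping.keys f" "word_op q w (unit_coord {}) S \<noteq> 0"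
    unfolding wcoord_def alg_op_def by (metis (no_types, lifting) mult_zero_right sum.neutral)
  with *[of "letters w" S] show ?thesis by (auto simp: word_op_def)
qed

lemma coset_normal_form:
  "wedge_ideal q +>\<^bsub>free_algebra\<^esub> normal_form (wcoord q f) = wedge_ideal q +>\<^bsub>free_algebra\<^esub> f"
  by (simp add: wedge.coset_eq_iff wcoord_normal_form)

text \<open>A given representative of a class need not be homogeneous. The normal form of its
  coordinates is, and it represents the same class.\<close>

lemma carrier_wedge_deg:
  "carrier (wedge_deg q s) = {X \<in> carrier (wedge q). \<forall>S. card S \<noteq> s \<longrightarrow> wedge_coord q X S = 0}"
    (is "?L = ?R")
proof (rule equalityI; rule subsetI)
  fix X assume "X \<in> ?L"
  then obtain f where f: "X = wedge_ideal q +>\<^bsub>free_algebra\<^esub> f"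
    "\<forall>w\<in>Poly_Mapping.keys f. length (letters w) = s"
    by (auto simp: wedge_deg_def)
  then have "wcoord q f S = 0" if "card S \<noteq> s" for S
    using wcoord_support[of q f S] that by auto
  with f show "X \<in> ?R" by (auto simp: carrier_wedge)
next
  fix X assume X: "X \<in> ?R"
  then obtain f where f: "X = wedge_ideal q +>\<^bsub>free_algebra\<^esub> f" by (auto simp: carrier_wedge)
  have deg: "card S = s" if "wcoord q f S \<noteq> 0" for S
    using X that by (auto simp: f)
  have "length (letters w) = s" if "w \<in> Poly_Mapping.keys (normal_form (wcoord q f))" for w
  proof -
    from that obtain S where "w \<in> Poly_Mapping.keys (scalar (wcoord q f S) * word_elem (sorted_list_of_set S))"
      unfolding normal_form_def using keys_sum by (metis (no_types, lifting) UN_E subsetD)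
    then show ?thesis using deg[of S]
      by (auto simp: scalar_def word_elem_def mult_single split: if_splits)
  qed
  moreover have "X = wedge_ideal q +>\<^bsub>free_algebra\<^esub> normal_form (wcoord q f)"
    by (simp add: f coset_normal_form)
  ultimately show "X \<in> ?L" unfolding wedge_deg_def by auto
qed

lemma wedge_deg_simps [simp]:
  "\<zero>\<^bsub>wedge_deg q s\<^esub> = \<zero>\<^bsub>wedge q\<^esub>" "X \<oplus>\<^bsub>wedge_deg q s\<^esub> Y = X \<oplus>\<^bsub>wedge q\<^esub> Y"
  "c \<odot>\<^bsub>wedge_deg q s\<^esub> X = c \<odot>\<^bsub>wedge q\<^esub> X"
  by (simp_all add: wedge_deg_def)

lemma coordinates_wedge_deg: "coordinates (wedge_deg q s) (wedge_coord q)"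
proof -
  interpret coordinates "wedge q" "wedge_coord q" by (rule coordinates_wedge)
  have "wedge_deg q s = (wedge q)\<lparr>carrier := carrier (wedge_deg q s)\<rparr>"
    by (simp add: wedge_deg_def)
  moreover have "coordinates ((wedge q)\<lparr>carrier := carrier (wedge_deg q s)\<rparr>) (wedge_coord q)"
    by (rule coordinates_subspace[OF coordinates_wedge]) (auto simp: carrier_wedge_deg)
  ultimately show ?thesis by metis
qed

section \<open>The coordinate complex\<close>

text \<open>The factor \<open>wsign 1 j S\<close> is the plain sign \<open>(-1)\<^sup>r\<close>, with \<open>r\<close> the number of elements of \<open>S\<close> below \<open>j\<close>.\<close>

definition koszul :: "('n::linorder \<Rightarrow> 'k::field) \<Rightarrow> ('n set \<Rightarrow> 'k) \<Rightarrow> 'n set \<Rightarrow> 'k" where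
  "koszul c g S = (\<Sum>j\<in>S. c j * wsign 1 j S * g (S - {j}))"

text \<open>Contraction with the direction \<open>p\<close>, divided by the coefficient
  \<open>c p\<close>: the usual contracting homotopy of a Koszul complex.\<close>

definition koszul_htpy :: "('n::linorder \<Rightarrow> 'k::field) \<Rightarrow> 'n \<Rightarrow> ('n set \<Rightarrow> 'k) \<Rightarrow> 'n set \<Rightarrow> 'k" where
  "koszul_htpy c p g T = (if p \<in> T then 0 else inverse (c p) * wsign 1 p T * g (insert p T))"

lemma wsign_1_square: "wsign 1 j S * wsign 1 j S = 1"
  by (simp add: wsign_def power_mult_distrib[symmetric])

lemma wsign_1_swap:
  fixes i j :: "'n::{finite,linorder}"
  assumes "i \<noteq> j" "i \<in> S" "j \<in> S"
  shows "wsign 1 j S * wsign 1 i (S - {j}) = - (wsign 1 i S * wsign 1 j (S - {i}) :: 'k::field)"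
proof (cases "i < j")
  case True
  then show ?thesis
    using wsign_Diff_less[of i j S "1 :: 'k"] wsign_Diff_ge[of i j "1 :: 'k" S] assms by simp
next
  case False
  then have "j < i" using assms by auto
  then show ?thesis
    using wsign_Diff_less[of j i S "1 :: 'k"] wsign_Diff_ge[of j i "1 :: 'k" S] assms by simp
qed

lemma koszul_koszul:
  fixes c :: "'n::{finite,linorder} \<Rightarrow> 'k::field_char_0"
  shows "koszul c (koszul c g) S = 0"
proof -
  let ?t = "\<lambda>j i. if i = j then 0 else
    c j * wsign 1 j S * (c i * wsign 1 i (S - {j}) * g (S - {j} - {i}))"
  let ?X = "\<Sum>j\<in>S. \<Sum>i\<in>S. ?t j i"
  have "koszul c (koszul c g) S = ?X"
    unfolding koszul_def sum_distrib_left
  proof (rule sum.cong[OF refl])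
    fix j
    show "(\<Sum>i\<in>S - {j}. c j * wsign 1 j S * (c i * wsign 1 i (S - {j}) * g (S - {j} - {i})))
      = (\<Sum>i\<in>S. ?t j i)"
      by (rule sum.mono_neutral_cong_left) auto
  qed
  \<comment> \<open>Exchanging the order in which two elements are removed flips the sign of a term.
    That \<open>?X = - ?X\<close> forces \<open>?X = 0\<close> uses characteristic 0.\<close>
  moreover have "?X = - ?X"
  proof -
    have anti: "?t j i = - ?t i j" if "i \<in> S" "j \<in> S" for i j
    proof (cases "i = j")
      case False
      have sets: "S - {j} - {i} = S - {i} - {j}" by auto
      have "?t j i = c i * c j * (wsign 1 j S * wsign 1 i (S - {j})) * g (S - {i} - {j})"
        using False by (simp add: sets mult_ac)
      also have "\<dots> = - (c i * c j * (wsign 1 i S * wsign 1 j (S - {i})) * g (S - {i} - {j}))"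
        unfolding wsign_1_swap[OF False that] by simp
      also have "\<dots> = - ?t i j" using False by (simp add: mult_ac)
      finally show ?thesis .
    qed simp
    have "?X = (\<Sum>j\<in>S. \<Sum>i\<in>S. - ?t i j)"
      by (rule sum.cong[OF refl], rule sum.cong[OF refl], rule anti)
    also have "\<dots> = (\<Sum>i\<in>S. \<Sum>j\<in>S. - ?t i j)" by (rule sum.swap)
    finally show ?thesis by (simp only: sum_negf)
  qed
  ultimately show ?thesis by simp
qed

text \<open>The identity "d h + h d = 1" for the homotopy, read on a closed \<open>g\<close>. If
  \<open>p\<close> lies in \<open>S\<close>, only the summand \<open>j = p\<close> survives, since
  the homotopy vanishes on sets containing \<open>p\<close>.\<close>

lemma koszul_contraction:
  fixes c :: "'n::{finite,linorder} \<Rightarrow> 'k::field"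
  assumes "c p \<noteq> 0" and closed: "\<And>S. koszul c g S = 0"
  shows "koszul c (koszul_htpy c p g) S = g S"
proof (cases "p \<in> S")
  case True
  have "koszul c (koszul_htpy c p g) S
      = (\<Sum>j\<in>{p}. c j * wsign 1 j S * koszul_htpy c p g (S - {j}))"
    unfolding koszul_def using True
    by (intro sum.mono_neutral_right) (auto simp: koszul_htpy_def)
  also have "\<dots> = c p * inverse (c p) * (wsign 1 p S * wsign 1 p (S - {p})) * g S"
    using True by (simp add: koszul_htpy_def insert_absorb)
  also have "\<dots> = g S"
  proof -
    have "wsign 1 p S * wsign 1 p (S - {p}) = (1 :: 'k)"
      by (simp add: wsign_Diff_ge wsign_1_square)
    then show ?thesis using assms(1) by simp
  qed
  finally show ?thesis .
next
  case False
  let ?S = "insert p S"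
  \<comment> \<open>This is \<open>wsign_1_swap\<close> on \<open>?S\<close>, with factors moved
    across by the fact that plain signs square to 1.\<close>
  have sign: "wsign 1 j S * wsign 1 p (S - {j}) = - (wsign 1 p S * wsign 1 j ?S :: 'k)"
    if "j \<in> S" for j
  proof -
    have "wsign 1 j ?S * wsign 1 p (?S - {j}) = - (wsign 1 p ?S * wsign 1 j (?S - {p}) :: 'k)"
      by (rule wsign_1_swap) (use that False in auto)
    moreover have "?S - {j} = insert p (S - {j})" "?S - {p} = S" using that False by auto
    ultimately have *: "wsign 1 j ?S * wsign 1 p (S - {j}) = - (wsign 1 p S * wsign 1 j S :: 'k)"
      by (simp add: wsign_insert_self)
    have "wsign 1 p S * wsign 1 j ?S
        = wsign 1 p S * (wsign 1 j ?S * wsign 1 p (S - {j})) * (wsign 1 p (S - {j}) :: 'k)"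
      using wsign_1_square[of p "S - {j}", where 'a = 'k] by (simp add: mult.assoc)
    also have "\<dots> = - (wsign 1 p S * wsign 1 p S) * (wsign 1 j S * wsign 1 p (S - {j}))"
      unfolding * by (simp add: mult.assoc)
    finally show ?thesis by (simp add: wsign_1_square)
  qed
  \<comment> \<open>Closedness is applied at \<open>?S\<close>: the summand \<open>j = p\<close>
    contains \<open>g S\<close>, and the others are those of the sum to be computed.\<close>
  have "0 = koszul c g ?S" using closed by simp
  also have "\<dots> = c p * wsign 1 p S * g S + (\<Sum>j\<in>S. c j * wsign 1 j ?S * g (?S - {j}))"
    unfolding koszul_def using False by (simp add: wsign_insert_self)
  finally have eq: "(\<Sum>j\<in>S. c j * wsign 1 j ?S * g (?S - {j})) = - (c p * wsign 1 p S * g S)"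
    by (simp add: eq_neg_iff_add_eq_0 add.commute)
  have "koszul c (koszul_htpy c p g) S
      = (\<Sum>j\<in>S. - inverse (c p) * wsign 1 p S * (c j * wsign 1 j ?S * g (?S - {j})))"
    unfolding koszul_def
  proof (rule sum.cong[OF refl])
    fix j assume j: "j \<in> S"
    then have "?S - {j} = insert p (S - {j})" using False by auto
    then have "c j * wsign 1 j S * koszul_htpy c p g (S - {j})
        = c j * inverse (c p) * (wsign 1 j S * wsign 1 p (S - {j})) * g (?S - {j})"
      using False by (simp add: koszul_htpy_def mult_ac)
    then show "c j * wsign 1 j S * koszul_htpy c p g (S - {j})
        = - inverse (c p) * wsign 1 p S * (c j * wsign 1 j ?S * g (?S - {j}))"
      unfolding sign[OF j] by (simp add: mult_ac)
  qed
  also have "\<dots> = - inverse (c p) * wsign 1 p S * - (c p * wsign 1 p S * g S)"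
    by (simp only: sum_distrib_left[symmetric] eq)
  also have "\<dots> = (inverse (c p) * c p) * (wsign 1 p S * wsign 1 p S) * g S"
    by (simp add: mult_ac)
  also have "\<dots> = g S" using assms(1) by (simp add: wsign_1_square)
  finally show ?thesis .
qed

section \<open>Splitting by multidegree\<close>

definition total_deg :: "('n \<Rightarrow> nat) \<Rightarrow> 'n set \<Rightarrow> 'n \<Rightarrow> nat" where
  "total_deg \<alpha> S i = \<alpha> i + (if i \<in> S then 1 else 0)"

definition remove_deg :: "('n \<Rightarrow> nat) \<Rightarrow> 'n set \<Rightarrow> 'n \<Rightarrow> nat" where
  "remove_deg \<beta> S i = \<beta> i - (if i \<in> S then 1 else 0)"

text \<open>The part of multidegree \<open>\<beta>\<close>; the guard excludes the truncated subtraction in \<open>remove_deg\<close>.\<close>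

definition slice :: "(('n \<Rightarrow> nat) \<times> 'n set \<Rightarrow> 'k) \<Rightarrow> ('n \<Rightarrow> nat) \<Rightarrow> 'n set \<Rightarrow> 'k::zero" where
  "slice F \<beta> S = (if \<forall>i\<in>S. 0 < \<beta> i then F (remove_deg \<beta> S, S) else 0)"

text \<open>The differential in coordinates. The coefficient at \<open>(\<alpha>, S)\<close>
  collects the forms in which one \<open>dx_j\<close> is traded back for a factor
  \<open>x_j\<close>; raising entry \<open>j\<close> does not affect the exponent of
  \<open>q\<close>, which sums over \<open>i < j\<close> only.\<close>

definition dcoord ::
    "'k::field \<Rightarrow> (('n::{finite,linorder} \<Rightarrow> nat) \<times> 'n set \<Rightarrow> 'k) \<Rightarrow> ('n \<Rightarrow> nat) \<times> 'n set \<Rightarrow> 'k" where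
  "dcoord q F = (\<lambda>(\<alpha>, S). \<Sum>j\<in>S. q powi (- (\<Sum>i | i < j. int (\<alpha> i))) * wsign q j S
    * F (\<alpha>(j := Suc (\<alpha> j)), S - {j}))"

text \<open>No monomial of multidegree \<open>\<beta>\<close> involves \<open>dx\<^sub>j\<close> if \<open>\<beta> j = 0\<close>; with coefficient 0 in these
  directions, \<open>slice_dcoord\<close> holds on all sets \<open>S\<close>.\<close>

definition dcoef :: "'k::field \<Rightarrow> ('n::{finite,linorder} \<Rightarrow> nat) \<Rightarrow> 'n \<Rightarrow> 'k" where
  "dcoef q \<beta> j = (if \<beta> j = 0 then 0 else q powi (- (\<Sum>i | i < j. int (\<beta> i))))"

lemma remove_total_deg [simp]: "remove_deg (total_deg \<alpha> S) S = \<alpha>"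
  by (auto simp: remove_deg_def total_deg_def)

lemma total_remove_deg: "\<forall>i\<in>S. 0 < \<beta> i \<Longrightarrow> total_deg (remove_deg \<beta> S) S = \<beta>"
  by (auto simp: remove_deg_def total_deg_def fun_eq_iff)

lemma slice_total_deg: "slice F (total_deg \<alpha> S) S = F (\<alpha>, S)"
proof -
  have "\<forall>i\<in>S. 0 < total_deg \<alpha> S i" by (simp add: total_deg_def)
  then show ?thesis by (simp add: slice_def)
qed

lemma slice_inject: "(\<And>\<beta>. slice F \<beta> = slice G \<beta>) \<Longrightarrow> F = G"
  by (metis ext slice_total_deg surj_pair)

text \<open>The power of \<open>q\<close> in \<open>wsign q j S\<close> counts the elements of
  \<open>S\<close> below \<open>j\<close>, which is exactly by how much the entries of the
  multidegree below \<open>j\<close> exceed those of \<open>\<alpha>\<close>. Only the plain sign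
  still depends on \<open>S\<close>.\<close>

lemma dcoef_total_deg:
  fixes q :: "'k::field" and S :: "'n::{finite,linorder} set"
  assumes "q \<noteq> 0" "j \<in> S"
  shows "q powi (- (\<Sum>i | i < j. int (\<alpha> i))) * wsign q j S = dcoef q (total_deg \<alpha> S) j * wsign 1 j S"
proof -
  have card: "(\<Sum>i | i < j. if i \<in> S then 1 else 0) = int (card {i \<in> S. i < j})"
  proof -
    have "(\<Sum>i | i < j. if i \<in> S then 1 else 0) = (\<Sum>i | i < j \<and> i \<in> S. 1 :: int)"
      by (rule sum.mono_neutral_cong_right) auto
    moreover have "{i. i < j \<and> i \<in> S} = {i \<in> S. i < j}" by auto
    ultimately show ?thesis by simp
  qed
  have "(\<Sum>i | i < j. int (total_deg \<alpha> S i)) = (\<Sum>i | i < j. int (\<alpha> i) + (if i \<in> S then 1 else 0))"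
    by (intro sum.cong) (auto simp: total_deg_def)
  also have "\<dots> = (\<Sum>i | i < j. int (\<alpha> i)) + int (card {i \<in> S. i < j})"
    by (simp add: sum.distrib card)
  finally have "q powi (- (\<Sum>i | i < j. int (total_deg \<alpha> S i)))
      = q powi (- (\<Sum>i | i < j. int (\<alpha> i))) * inverse q ^ card {i \<in> S. i < j}"
    using assms(1) by (simp add: power_int_add power_int_minus power_int_diff field_simps power_inverse)
  moreover have "wsign q j S = wsign 1 j S * inverse q ^ card {i \<in> S. i < j}"
    unfolding wsign_def by (simp add: power_mult_distrib[symmetric])
  ultimately show ?thesis using assms(2) by (simp add: dcoef_def total_deg_def)
qed

lemma slice_dcoord:
  fixes q :: "'k::field" and \<beta> :: "'n::{finite,linorder} \<Rightarrow> nat"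
  assumes q: "q \<noteq> 0"
  shows "slice (dcoord q F) \<beta> = koszul (dcoef q \<beta>) (slice F \<beta>)"
proof
  fix S
  show "slice (dcoord q F) \<beta> S = koszul (dcoef q \<beta>) (slice F \<beta>) S"
  proof (cases "\<forall>i\<in>S. 0 < \<beta> i")
    case True
    have "q powi (- (\<Sum>i | i < j. int (remove_deg \<beta> S i))) * wsign q j S
          * F ((remove_deg \<beta> S)(j := Suc (remove_deg \<beta> S j)), S - {j})
        = dcoef q \<beta> j * wsign 1 j S * slice F \<beta> (S - {j})" if "j \<in> S" for j
    proof -
      \<comment> \<open>Trading \<open>dx_j\<close> for \<open>x_j\<close> preserves the
        multidegree.\<close>
      have "(remove_deg \<beta> S)(j := Suc (remove_deg \<beta> S j)) = remove_deg \<beta> (S - {j})"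
        using True that by (auto simp: remove_deg_def fun_eq_iff)
      then show ?thesis
        using True dcoef_total_deg[OF q that, of "remove_deg \<beta> S"]
        by (simp add: total_remove_deg slice_def)
    qed
    then have "dcoord q F (remove_deg \<beta> S, S) = koszul (dcoef q \<beta>) (slice F \<beta>) S"
      by (simp add: dcoord_def koszul_def)
    then show ?thesis using True by (simp add: slice_def[of "dcoord q F"])
  next
    case False
    then obtain i where i: "i \<in> S" "\<beta> i = 0" by auto
    \<comment> \<open>For \<open>j = i\<close> the coefficient is 0; for any other \<open>j\<close>
      the element \<open>i\<close> stays in \<open>S - {j}\<close> and the guard in
      \<open>slice\<close> applies.\<close>
    have "dcoef q \<beta> j * wsign 1 j S * slice F \<beta> (S - {j}) = 0" for j
    proof (cases "i = j")
      case False
      then have "\<not> (\<forall>k\<in>S - {j}. 0 < \<beta> k)" using i by (intro notI) (drule bspec[of _ _ i], auto)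
      then have "slice F \<beta> (S - {j}) = 0" unfolding slice_def by (rule if_not_P)
      then show ?thesis by simp
    qed (use i in \<open>simp add: dcoef_def\<close>)
    then show ?thesis using False by (auto simp: slice_def[of "dcoord q F"] koszul_def)
  qed
qed

lemma dcoord_dcoord:
  fixes q :: "'k::field_char_0"
  assumes "q \<noteq> 0"
  shows "dcoord q (dcoord q F) = (\<lambda>_. 0)"
  by (rule slice_inject) (simp add: slice_dcoord[OF assms] koszul_koszul fun_eq_iff, simp add: slice_def)

section \<open>Exactness under the bound on exponents\<close>

definition bounded_forms :: "nat \<Rightarrow> nat \<Rightarrow> (('n \<Rightarrow> nat) \<times> 'n set \<Rightarrow> 'k::zero) set" where
  "bounded_forms N s = {F. \<forall>\<alpha> S. F (\<alpha>, S) \<noteq> 0 \<longrightarrow> card S = s \<and> (\<forall>i. \<alpha> i \<le> N)}"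

definition top_exp :: "nat \<Rightarrow> 'n set \<Rightarrow> 'n \<Rightarrow> nat" where
  "top_exp N S i = (if i \<in> S then N else 0)"

lemma dcoord_bounded:
  assumes F: "F \<in> bounded_forms N s"
  shows "dcoord q F \<in> bounded_forms N (Suc s)"
  unfolding bounded_forms_def
proof (intro CollectI allI impI)
  fix \<alpha> :: "'a \<Rightarrow> nat" and S
  assume "dcoord q F (\<alpha>, S) \<noteq> 0"
  then obtain j where j: "j \<in> S" "F (\<alpha>(j := Suc (\<alpha> j)), S - {j}) \<noteq> 0"
    unfolding dcoord_def by (auto elim: sum.not_neutral_contains_not_neutral)
  with F have *: "card (S - {j}) = s" "\<forall>i. (\<alpha>(j := Suc (\<alpha> j))) i \<le> N"
    unfolding bounded_forms_def by blast+
  have "\<alpha> i \<le> N" for i using *(2)[rule_format, of i] by (cases "i = j") auto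
  then show "card S = Suc s \<and> (\<forall>i. \<alpha> i \<le> N)" using * j by (metis card_Suc_Diff1 finite)
qed

text \<open>A contribution would have to come from a form with exponent \<open>N + 1\<close> in some
  direction of \<open>S\<close>. Hence coboundaries have no coefficient on the surviving
  forms.\<close>

lemma dcoord_top:
  assumes "F \<in> bounded_forms N s"
  shows "dcoord q F (top_exp N S, S) = 0"
proof -
  have "F ((top_exp N S)(j := Suc (top_exp N S j)), S - {j}) = 0" if "j \<in> S" for j
  proof (rule ccontr)
    assume "F ((top_exp N S)(j := Suc (top_exp N S j)), S - {j}) \<noteq> 0"
    then have "((top_exp N S)(j := Suc (top_exp N S j))) j \<le> N"
      using assms by (auto simp only: bounded_forms_def)
    then show False using that by (simp add: top_exp_def)
  qed
  then show ?thesis by (simp add: dcoord_def)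
qed

text \<open>In multidegree \<open>\<beta>\<close>, the factor \<open>dx_i\<close> is impossible if
  \<open>\<beta> i = 0\<close>, and the bound forces it if \<open>\<beta> i > N\<close>. In the
  remaining directions both choices are open.\<close>

definition free_dirs :: "nat \<Rightarrow> ('n \<Rightarrow> nat) \<Rightarrow> 'n set" where
  "free_dirs N \<beta> = {i. 0 < \<beta> i \<and> \<beta> i \<le> N}"

text \<open>Each multidegree is contracted along one free direction; without such a direction only a
  coefficient excluded by \<open>top\<close> could survive. The form \<open>Suc (card T) = s\<close>
  of the degree condition also covers \<open>s = 0\<close>, where it forces \<open>G\<close> to
  vanish.\<close>

lemma cocycle_is_coboundary:
  fixes q :: "'k::field" and F :: "('n::{finite,linorder} \<Rightarrow> nat) \<times> 'n set \<Rightarrow> 'k"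
  assumes q: "q \<noteq> 0" and F: "F \<in> bounded_forms N s" and closed: "dcoord q F = (\<lambda>_. 0)"
    and top: "\<And>S. F (top_exp N S, S) = 0"
  shows "\<exists>G. dcoord q G = F \<and> (\<forall>\<alpha> T. G (\<alpha>, T) \<noteq> 0 \<longrightarrow> Suc (card T) = s \<and> (\<forall>i. \<alpha> i \<le> N))"
proof -
  define p where "p \<beta> = (SOME i. i \<in> free_dirs N \<beta>)" for \<beta> :: "'n \<Rightarrow> nat"
  have p: "0 < \<beta> (p \<beta>)" "\<beta> (p \<beta>) \<le> N" if "free_dirs N \<beta> \<noteq> {}" for \<beta>
    using someI_ex[of "\<lambda>i. i \<in> free_dirs N \<beta>"] that by (auto simp: p_def free_dirs_def)
  define g where "g \<beta> = (if free_dirs N \<beta> = {} then (\<lambda>_. 0)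
    else koszul_htpy (dcoef q \<beta>) (p \<beta>) (slice F \<beta>))" for \<beta>
  define G where "G = (\<lambda>(\<alpha>, T). g (total_deg \<alpha> T) T)"
  \<comment> \<open>Where the guard on \<open>G\<close> fails, \<open>g \<beta>\<close> vanishes as
    well, because the guard of \<open>slice F\<close> fails on the larger set
    \<open>insert (p \<beta>) T\<close>.\<close>
  have slice_G: "slice G \<beta> = g \<beta>" for \<beta>
    by (rule ext) (auto simp: slice_def G_def total_remove_deg g_def koszul_htpy_def)
  have "slice (dcoord q G) \<beta> = slice F \<beta>" for \<beta>
  proof (cases "free_dirs N \<beta> = {}")
    case True
    have "slice F \<beta> S = 0" for S
    proof (rule ccontr)
      assume *: "slice F \<beta> S \<noteq> 0"
      then have pos: "\<forall>i\<in>S. 0 < \<beta> i" and nz: "F (remove_deg \<beta> S, S) \<noteq> 0"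
        by (auto simp: slice_def split: if_splits)
      have "remove_deg \<beta> S i \<le> N" for i using nz F by (auto simp: bounded_forms_def)
      then have "remove_deg \<beta> S i = top_exp N S i" for i
      proof -
        \<comment> \<open>Together with the exponent bound this leaves
          \<open>\<beta> i = N + 1\<close> for \<open>i\<close> in \<open>S\<close> and
          \<open>\<beta> i = 0\<close> elsewhere.\<close>
        have "\<beta> i = 0 \<or> N < \<beta> i" using True by (auto simp: free_dirs_def)
        moreover have "i \<in> S \<Longrightarrow> 0 < \<beta> i" using pos by blast
        ultimately show ?thesis
          using \<open>remove_deg \<beta> S i \<le> N\<close> by (cases "i \<in> S") (auto simp: remove_deg_def top_exp_def)
      qed
      then have "remove_deg \<beta> S = top_exp N S" by auto
      with nz top show False by simp
    qed
    then show ?thesis using True by (simp add: slice_dcoord[OF q] slice_G g_def koszul_def fun_eq_iff)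
  next
    case False
    have "koszul (dcoef q \<beta>) (slice F \<beta>) S = 0" for S
      using slice_dcoord[OF q, of F \<beta>] closed by (metis slice_def)
    moreover have "dcoef q \<beta> (p \<beta>) \<noteq> 0" using p[OF False] q by (simp add: dcoef_def)
    ultimately show ?thesis
      using False by (simp add: slice_dcoord[OF q] slice_G g_def koszul_contraction fun_eq_iff)
  qed
  then have "dcoord q G = F" by (rule slice_inject)
  moreover have "Suc (card T) = s \<and> (\<forall>i. \<alpha> i \<le> N)" if "G (\<alpha>, T) \<noteq> 0" for \<alpha> T
  proof -
    let ?\<beta> = "total_deg \<alpha> T"
    let ?T = "insert (p ?\<beta>) T"
    have free: "free_dirs N ?\<beta> \<noteq> {}" and pT: "p ?\<beta> \<notin> T" and nz: "slice F ?\<beta> ?T \<noteq> 0"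
      using that by (auto simp: G_def g_def koszul_htpy_def split: if_splits)
    then have "F (remove_deg ?\<beta> ?T, ?T) \<noteq> 0" by (auto simp: slice_def split: if_splits)
    with F have *: "card ?T = s" "\<And>i. remove_deg ?\<beta> ?T i \<le> N" by (auto simp: bounded_forms_def)
    \<comment> \<open>The homotopy returns a factor \<open>x_i\<close> only for
      \<open>i = p ?\<beta>\<close>. There the exponent becomes \<open>?\<beta> i\<close>, which is
      at most \<open>N\<close> because the direction is free.\<close>
    have "\<alpha> i \<le> N" for i
      using *(2)[of i] p(2)[OF free] pT
      by (cases "i = p ?\<beta>") (auto simp: remove_deg_def total_deg_def split: if_splits)
    then show ?thesis using *(1) pT by simp
  qed
  ultimately show ?thesis by blast
qed

section \<open>Cohomology of the truncated complex\<close>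

definition form_coord ::
    "'k::field \<Rightarrow> (('n::{finite,linorder} \<Rightarrow> nat) \<Rightarrow> ('n free_word \<Rightarrow>\<^sub>0 'k) set)
     \<Rightarrow> ('n \<Rightarrow> nat) \<times> 'n set \<Rightarrow> 'k" where
  "form_coord q = (\<lambda>\<omega> (\<alpha>, S). wedge_coord q (\<omega> \<alpha>) S)"

lemma coordinates_forms: "coordinates (free_tensor B (wedge_deg q s)) (form_coord q)"
  unfolding form_coord_def by (rule coordinates_free_tensor[OF coordinates_wedge_deg])

lemma wedge_coord_zero [simp]: "wedge_coord q \<zero>\<^bsub>wedge q\<^esub> S = 0"
  by (rule coordinates.coord_zero[OF coordinates_wedge])

lemma wedge_zero_closed [simp]: "\<zero>\<^bsub>wedge q\<^esub> \<in> carrier (wedge q)"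
  by (rule coordinates.zero_closed[OF coordinates_wedge])

lemma wedge_coord_eq_zero:
  "X \<in> carrier (wedge q) \<Longrightarrow> (\<And>S. wedge_coord q X S = 0) \<Longrightarrow> X = \<zero>\<^bsub>wedge q\<^esub>"
  by (rule coordinates.coord_inj[OF coordinates_wedge[of q]]) simp_all

lemma carrier_forms:
  "\<omega> \<in> carrier (free_tensor B (wedge_deg q s)) \<longleftrightarrow>
    (\<forall>\<alpha>. \<omega> \<alpha> \<in> carrier (wedge q)) \<and> finite {\<alpha>. \<omega> \<alpha> \<noteq> \<zero>\<^bsub>wedge q\<^esub>} \<and>
    (\<forall>\<alpha> S. form_coord q \<omega> (\<alpha>, S) \<noteq> 0 \<longrightarrow> card S = s \<and> \<alpha> \<in> B)" (is "_ \<longleftrightarrow> ?R")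
proof
  assume "\<omega> \<in> carrier (free_tensor B (wedge_deg q s))"
  then have *: "\<And>\<alpha>. \<omega> \<alpha> \<in> carrier (wedge_deg q s)" "finite {\<alpha>. \<omega> \<alpha> \<noteq> \<zero>\<^bsub>wedge q\<^esub>}"
    "\<And>\<alpha>. \<alpha> \<notin> B \<Longrightarrow> \<omega> \<alpha> = \<zero>\<^bsub>wedge q\<^esub>"
    by (simp_all add: free_tensor_def)
  have "card S = s \<and> \<alpha> \<in> B" if "form_coord q \<omega> (\<alpha>, S) \<noteq> 0" for \<alpha> S
    using that *(1)[of \<alpha>] *(3)[of \<alpha>] by (auto simp: form_coord_def carrier_wedge_deg)
  with * show ?R by (simp add: carrier_wedge_deg)
next
  assume R: ?R
  have "\<omega> \<alpha> = \<zero>\<^bsub>wedge q\<^esub>" if "\<alpha> \<notin> B" for \<alpha>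
  proof (rule wedge_coord_eq_zero)
    show "wedge_coord q (\<omega> \<alpha>) S = 0" for S
      using R that by (auto simp: form_coord_def)
  qed (use R in blast)
  moreover have "\<omega> \<alpha> \<in> carrier (wedge_deg q s)" for \<alpha>
    using R by (auto simp: carrier_wedge_deg form_coord_def)
  ultimately show "\<omega> \<in> carrier (free_tensor B (wedge_deg q s))"
    using R by (simp add: free_tensor_def)
qed

lemma finite_bounded_exponents: "finite {\<alpha> :: 'n::finite \<Rightarrow> nat. \<forall>i. \<alpha> i \<le> N}"
  using finite_set_of_finite_funs[of "UNIV :: 'n set" "{..N}" 0] by simp

text \<open>Finiteness of the support comes for free, as there are only finitely many bounded
  exponents.\<close>

lemma carrier_Omega_sub:
  "\<omega> \<in> carrier (Omega_sub q m s) \<longleftrightarrow>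
    (\<forall>\<alpha>. \<omega> \<alpha> \<in> carrier (wedge q)) \<and> form_coord q \<omega> \<in> bounded_forms (m * qchar q - 1) s"
proof -
  have "finite {\<alpha>. \<omega> \<alpha> \<noteq> \<zero>\<^bsub>wedge q\<^esub>}"
    if carr: "\<forall>\<alpha>. \<omega> \<alpha> \<in> carrier (wedge q)" and bnd: "form_coord q \<omega> \<in> bounded_forms (m * qchar q - 1) s"
  proof (rule finite_subset[OF _ finite_bounded_exponents])
    show "{\<alpha>. \<omega> \<alpha> \<noteq> \<zero>\<^bsub>wedge q\<^esub>} \<subseteq> {\<alpha>. \<forall>i. \<alpha> i \<le> m * qchar q - 1}"
    proof (rule subsetI)
      fix \<alpha> assume "\<alpha> \<in> {\<alpha>. \<omega> \<alpha> \<noteq> \<zero>\<^bsub>wedge q\<^esub>}"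
      then have "\<omega> \<alpha> \<noteq> \<zero>\<^bsub>wedge q\<^esub>" by simp
      then obtain S where "wedge_coord q (\<omega> \<alpha>) S \<noteq> 0"
        using carr wedge_coord_eq_zero[of "\<omega> \<alpha>" q] by metis
      then have "form_coord q \<omega> (\<alpha>, S) \<noteq> 0" by (simp add: form_coord_def)
      then show "\<alpha> \<in> {\<alpha>. \<forall>i. \<alpha> i \<le> m * qchar q - 1}"
        using bnd unfolding bounded_forms_def by blast
    qed
  qed
  then show ?thesis unfolding Omega_sub_def carrier_forms bounded_forms_def by blast
qed

lemma Omega_sub_coordinate_exists:
  assumes "F \<in> bounded_forms (m * qchar q - 1) s"
  shows "\<exists>\<omega>\<in>carrier (Omega_sub q m s). form_coord q \<omega> = F"
proof -
  define \<omega> where "\<omega> = (\<lambda>\<alpha>. wedge_ideal q +>\<^bsub>free_algebra\<^esub> normal_form (\<lambda>S. F (\<alpha>, S)))"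
  have "form_coord q \<omega> = F"
    by (simp add: form_coord_def \<omega>_def wcoord_normal_form fun_eq_iff)
  with assms show ?thesis by (intro bexI[of _ \<omega>]) (auto simp: carrier_Omega_sub \<omega>_def carrier_wedge)
qed

section \<open>The de Rham differential in coordinates\<close>

lemma star_eps: "star (eps j) \<beta> = (\<Sum>i | i < j. \<beta> i)"
proof -
  have "star (eps j) \<beta> = (\<Sum>t\<in>UNIV. if t < j then \<beta> t else 0)"
    unfolding star_def
  proof (rule sum.cong[OF refl])
    fix t
    have "(\<Sum>i | t < i. eps j i * \<beta> t) = (\<Sum>i | t < i. if i = j then \<beta> t else 0)"
      by (rule sum.cong) (auto simp: eps_def)
    then show "(\<Sum>i | t < i. eps j i * \<beta> t) = (if t < j then \<beta> t else 0)" by simp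
  qed
  also have "\<dots> = (\<Sum>i | i < j. \<beta> i)"
    by (rule sum.mono_neutral_cong_right) auto
  finally show ?thesis .
qed

lemma x_tensor_closed:
  assumes "X \<in> carrier (wedge_deg q s)"
  shows "x_tensor (wedge q) \<beta> X \<in> carrier (Omega q s)"
proof -
  \<comment> \<open>If \<open>\<beta>\<close> has a negative entry, no exponent matches and the left
    side is empty, so truncation by \<open>nat\<close> does no harm.\<close>
  have "{\<alpha>. x_tensor (wedge q) \<beta> X \<alpha> \<noteq> \<zero>\<^bsub>wedge q\<^esub>} \<subseteq> {\<lambda>i. nat (\<beta> i)}"
  proof (rule subsetI)
    fix \<alpha> assume "\<alpha> \<in> {\<alpha>. x_tensor (wedge q) \<beta> X \<alpha> \<noteq> \<zero>\<^bsub>wedge q\<^esub>}"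
    then have "\<forall>i. int (\<alpha> i) = \<beta> i" by (auto simp: x_tensor_def split: if_splits)
    then have "\<alpha> i = nat (\<beta> i)" for i by (metis nat_int)
    then show "\<alpha> \<in> {\<lambda>i. nat (\<beta> i)}" by auto
  qed
  then have "finite {\<alpha>. x_tensor (wedge q) \<beta> X \<alpha> \<noteq> \<zero>\<^bsub>wedge q\<^esub>}"
    by (rule finite_subset) simp
  then show ?thesis
    using assms by (simp add: Omega_def free_tensor_def carrier_wedge_deg x_tensor_def)
qed

lemma form_coord_x_tensor:
  "form_coord q (x_tensor (wedge q) \<beta> X) (\<alpha>, S) =
    (if \<forall>i. int (\<alpha> i) = \<beta> i then wedge_coord q X S else 0)"
  by (simp add: form_coord_def x_tensor_def)

lemma dx_mult_deg:
  assumes "X \<in> carrier (wedge_deg q s)"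
  shows "dx q j \<otimes>\<^bsub>wedge q\<^esub> X \<in> carrier (wedge_deg q (Suc s))"
proof -
  have X: "X \<in> carrier (wedge q)" using assms by (simp add: carrier_wedge_deg)
  have "lmul q j (wedge_coord q X) S = 0" if "card S \<noteq> Suc s" for S
  proof (cases "j \<in> S")
    case True
    then have "card (S - {j}) \<noteq> s" using that by (metis card_Suc_Diff1 finite)
    then have "wedge_coord q X (S - {j}) = 0" using assms unfolding carrier_wedge_deg by blast
    then show ?thesis by (simp add: lmul_def)
  qed (simp add: lmul_def)
  then show ?thesis by (simp add: carrier_wedge_deg dx_mult[OF X])
qed

text \<open>Taking coordinates turns the module sums into sums in the field, and at
  \<open>(\<alpha>, S)\<close> the direction \<open>j\<close> receives only the term with exponent
  \<open>\<alpha>\<close> raised at \<open>j\<close>.\<close>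

lemma dR_coord:
  fixes \<omega> :: "('n::{finite,linorder} \<Rightarrow> nat) \<Rightarrow> ('n free_word \<Rightarrow>\<^sub>0 'k::field) set"
  assumes \<omega>: "\<omega> \<in> carrier (Omega q s)"
  shows "dR q s \<omega> \<in> carrier (Omega q (Suc s))"
    and "form_coord q (dR q s \<omega>) = dcoord q (form_coord q \<omega>)"
proof -
  interpret V: coordinates "Omega q (Suc s) :: ('k, ('n \<Rightarrow> nat) \<Rightarrow> _) module" "form_coord q"
    unfolding Omega_def by (rule coordinates_forms)
  define A where "A = {\<alpha>. \<omega> \<alpha> \<noteq> \<zero>\<^bsub>wedge q\<^esub>}"
  define t where "t \<alpha> j = q powi (- star (eps j) (\<lambda>i. int (\<alpha> i)))
      \<odot>\<^bsub>Omega q (Suc s)\<^esub> x_tensor (wedge q) (\<lambda>i. int (\<alpha> i) - eps j i) (dx q j \<otimes>\<^bsub>wedge q\<^esub> \<omega> \<alpha>)"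
    for \<alpha> j
  have dR: "dR q s \<omega> = finsum (Omega q (Suc s)) (\<lambda>\<alpha>. finsum (Omega q (Suc s)) (t \<alpha>) UNIV) A"
    unfolding dR_def t_def A_def ..
  have fin: "finite A" using \<omega> by (simp add: Omega_def free_tensor_def A_def)
  have deg: "\<omega> \<alpha> \<in> carrier (wedge_deg q s)" for \<alpha>
    using \<omega> by (simp add: Omega_def free_tensor_def)
  then have wedge: "\<omega> \<alpha> \<in> carrier (wedge q)" for \<alpha> by (simp add: carrier_wedge_deg)
  have x: "x_tensor (wedge q) \<beta> (dx q j \<otimes>\<^bsub>wedge q\<^esub> \<omega> \<alpha>) \<in> carrier (Omega q (Suc s))" for \<beta> j \<alpha>
    by (intro x_tensor_closed dx_mult_deg deg)
  then have t: "t \<alpha> \<in> UNIV \<rightarrow> carrier (Omega q (Suc s))" for \<alpha>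
    unfolding t_def by (intro Pi_I V.smult_closed)
  have inner: "(\<lambda>\<alpha>. finsum (Omega q (Suc s)) (t \<alpha>) UNIV) \<in> A \<rightarrow> carrier (Omega q (Suc s))"
    using V.finsum_closed_coord[OF t] by blast
  show "dR q s \<omega> \<in> carrier (Omega q (Suc s))"
    unfolding dR using V.finsum_closed_coord[OF inner] by blast
  have "form_coord q (dR q s \<omega>) (\<alpha>, S) = dcoord q (form_coord q \<omega>) (\<alpha>, S)" for \<alpha> S
  proof -
    define c where "c j = q powi (- (\<Sum>i | i < j. int (\<alpha> i)))
      * lmul q j (wedge_coord q (\<omega> (\<alpha>(j := Suc (\<alpha> j))))) S" for j
    have coord_t: "form_coord q (t \<alpha>' j) (\<alpha>, S) = (if \<alpha>' = \<alpha>(j := Suc (\<alpha> j)) then c j else 0)" for \<alpha>' j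
    proof -
      have iff: "(\<forall>i. int (\<alpha> i) = int (\<alpha>' i) - eps j i) \<longleftrightarrow> \<alpha>' = \<alpha>(j := Suc (\<alpha> j))"
        (is "?L \<longleftrightarrow> ?R")
      proof
        assume ?L
        then have "\<alpha>' i = (\<alpha>(j := Suc (\<alpha> j))) i" for i
          by (cases "i = j") (auto simp: eps_def dest: spec[of _ i])
        then show ?R ..
      qed (simp add: eps_def)
      have "(\<Sum>i | i < j. int ((\<alpha>(j := Suc (\<alpha> j))) i)) = (\<Sum>i | i < j. int (\<alpha> i))"
        by (rule sum.cong) auto
      then show ?thesis
        by (simp add: t_def V.coord_smult[OF x] form_coord_x_tensor iff dx_mult[OF wedge] c_def star_eps)
    qed
    have "form_coord q (dR q s \<omega>) (\<alpha>, S) = (\<Sum>\<alpha>'\<in>A. \<Sum>j\<in>UNIV. form_coord q (t \<alpha>' j) (\<alpha>, S))"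
      unfolding dR by (simp only: V.coord_finsum[OF inner] V.coord_finsum[OF t])
    also have "\<dots> = (\<Sum>j\<in>UNIV. \<Sum>\<alpha>'\<in>A. if \<alpha>' = \<alpha>(j := Suc (\<alpha> j)) then c j else 0)"
      by (subst sum.swap) (simp only: coord_t)
    also have "\<dots> = (\<Sum>j\<in>UNIV. c j)"
    proof (rule sum.cong[OF refl])
      fix j
      \<comment> \<open>The sum runs over the support of \<open>\<omega>\<close> only; a raised
        exponent outside it would contribute 0 anyway.\<close>
      have "c j = 0" if "\<alpha>(j := Suc (\<alpha> j)) \<notin> A"
        using that by (simp add: A_def c_def lmul_def)
      then show "(\<Sum>\<alpha>'\<in>A. if \<alpha>' = \<alpha>(j := Suc (\<alpha> j)) then c j else 0) = c j"
        using fin by simp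
    qed
    also have "\<dots> = (\<Sum>j\<in>S. c j)"
      by (rule sum.mono_neutral_right) (auto simp: c_def lmul_def)
    also have "\<dots> = dcoord q (form_coord q \<omega>) (\<alpha>, S)"
      unfolding dcoord_def prod.case by (rule sum.cong) (auto simp: c_def lmul_def form_coord_def)
    finally show ?thesis .
  qed
  then show "form_coord q (dR q s \<omega>) = dcoord q (form_coord q \<omega>)" by auto
qed

lemma Omega_sub_subset: "carrier (Omega_sub q m s) \<subseteq> carrier (Omega q s)"
  by (auto simp: Omega_sub_def Omega_def free_tensor_def)

lemma dR_Omega_sub:
  assumes "\<omega> \<in> carrier (Omega_sub q m s)"
  shows "dR q s \<omega> \<in> carrier (Omega_sub q m (Suc s))"
    and "form_coord q (dR q s \<omega>) = dcoord q (form_coord q \<omega>)"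
proof -
  have \<omega>: "\<omega> \<in> carrier (Omega q s)" using assms Omega_sub_subset by blast
  show eq: "form_coord q (dR q s \<omega>) = dcoord q (form_coord q \<omega>)" by (rule dR_coord[OF \<omega>])
  have "dR q s \<omega> \<alpha> \<in> carrier (wedge q)" for \<alpha>
    using dR_coord(1)[OF \<omega>] by (simp add: Omega_def carrier_forms)
  then show "dR q s \<omega> \<in> carrier (Omega_sub q m (Suc s))"
    using assms by (simp add: carrier_Omega_sub eq dcoord_bounded)
qed

lemma coordinates_Omega_sub: "coordinates (Omega_sub q m s) (form_coord q)"
  unfolding Omega_sub_def by (rule coordinates_forms)

section \<open>Cocycles, coboundaries and the functionals that separate classes\<close>

lemma cocycles_coord:
  "cocycles q m s = {\<omega> \<in> carrier (Omega_sub q m s). dcoord q (form_coord q \<omega>) = (\<lambda>_. 0)}"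
proof -
  have "dR q s \<omega> = \<zero>\<^bsub>Omega_sub q m (Suc s)\<^esub> \<longleftrightarrow> dcoord q (form_coord q \<omega>) = (\<lambda>_. 0)"
    if "\<omega> \<in> carrier (Omega_sub q m s)" for \<omega> :: "('a \<Rightarrow> nat) \<Rightarrow> ('a free_word \<Rightarrow>\<^sub>0 'b) set"
  proof -
    interpret V: coordinates "Omega_sub q m (Suc s) :: ('b, ('a \<Rightarrow> nat) \<Rightarrow> _) module" "form_coord q"
      by (rule coordinates_Omega_sub)
    have "dR q s \<omega> = \<zero>\<^bsub>Omega_sub q m (Suc s)\<^esub> \<longleftrightarrow> (\<forall>b. form_coord q (dR q s \<omega>) b = 0)"
      using V.coord_inj[OF dR_Omega_sub(1)[OF that] V.zero_closed] by auto
    then show ?thesis by (simp add: dR_Omega_sub(2)[OF that] fun_eq_iff)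
  qed
  then show ?thesis unfolding cocycles_def by blast
qed

lemma dcoord_zero: "dcoord q (\<lambda>_. 0) = (\<lambda>_. 0)"
  by (auto simp: dcoord_def)

lemma dcoord_add: "dcoord q (\<lambda>b. F b + G b) = (\<lambda>b. dcoord q F b + dcoord q G b)"
  by (auto simp: dcoord_def algebra_simps sum.distrib)

lemma dcoord_scale: "dcoord q (\<lambda>b. c * F b) = (\<lambda>b. c * dcoord q F b)"
  by (auto simp: dcoord_def algebra_simps sum_distrib_left)

lemma coordinates_cocycles:
  fixes q :: "'k::field"
  shows "coordinates ((Omega_sub q m s)\<lparr>carrier := cocycles q m s\<rparr>
    :: ('k, ('n::{finite,linorder} \<Rightarrow> nat) \<Rightarrow> _) module) (form_coord q)"
proof (rule coordinates_subspace[OF coordinates_Omega_sub])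
  let ?V = "Omega_sub q m s :: ('k, ('n \<Rightarrow> nat) \<Rightarrow> _) module"
  interpret V: coordinates ?V "form_coord q" by (rule coordinates_Omega_sub)
  show "cocycles q m s \<subseteq> carrier ?V" by (auto simp: cocycles_def)
  have "form_coord q \<zero>\<^bsub>?V\<^esub> = (\<lambda>_. 0)" by auto
  then show "\<zero>\<^bsub>?V\<^esub> \<in> cocycles q m s"
    by (simp add: cocycles_coord dcoord_zero)
  fix x :: "('n \<Rightarrow> nat) \<Rightarrow> ('n free_word \<Rightarrow>\<^sub>0 'k) set" assume x: "x \<in> cocycles q m s"
  {
    fix y :: "('n \<Rightarrow> nat) \<Rightarrow> ('n free_word \<Rightarrow>\<^sub>0 'k) set" assume y: "y \<in> cocycles q m s"
    have "form_coord q (x \<oplus>\<^bsub>Omega_sub q m s\<^esub> y) = (\<lambda>b. form_coord q x b + form_coord q y b)"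
      using x y by (auto simp: cocycles_coord)
    then show "x \<oplus>\<^bsub>Omega_sub q m s\<^esub> y \<in> cocycles q m s"
      using x y by (simp add: cocycles_coord dcoord_add)
  }
  fix c
  have "form_coord q (c \<odot>\<^bsub>Omega_sub q m s\<^esub> x) = (\<lambda>b. c * form_coord q x b)"
    using x by (auto simp: cocycles_coord)
  then show "c \<odot>\<^bsub>Omega_sub q m s\<^esub> x \<in> cocycles q m s"
    using x by (simp add: cocycles_coord dcoord_scale)
qed

definition top_coord ::
    "'k::field \<Rightarrow> nat \<Rightarrow> (('n::{finite,linorder} \<Rightarrow> nat) \<Rightarrow> ('n free_word \<Rightarrow>\<^sub>0 'k) set) \<Rightarrow> 'n set \<Rightarrow> 'k" where
  "top_coord q m \<omega> S = form_coord q \<omega> (top_exp (m * qchar q - 1) S, S)"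

text \<open>One inclusion is \<open>dcoord_top\<close>, the other
  \<open>cocycle_is_coboundary\<close>. Presenting the coboundaries as a kernel makes the top
  coefficients coordinates on cohomology.\<close>

lemma coboundaries_eq_kernel:
  fixes q :: "'k::field_char_0"
  assumes q: "q \<noteq> 0"
  shows "(coboundaries q m s :: (('n::{finite,linorder} \<Rightarrow> nat) \<Rightarrow> _) set)
    = {\<omega> \<in> cocycles q m s. \<forall>S. top_coord q m \<omega> S = 0}" (is "?B = ?K")
proof (rule equalityI; rule subsetI)
  fix \<omega> :: "('n \<Rightarrow> nat) \<Rightarrow> ('n free_word \<Rightarrow>\<^sub>0 'k) set"
  assume "\<omega> \<in> ?B"
  show "\<omega> \<in> ?K"
  proof (cases s)
    case 0
    interpret C: coordinates "(Omega_sub q m s)\<lparr>carrier := cocycles q m s\<rparr> :: ('k, ('n \<Rightarrow> nat) \<Rightarrow> _) module" "form_coord q"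
      by (rule coordinates_cocycles)
    from \<open>\<omega> \<in> ?B\<close> 0 have "\<omega> = \<zero>\<^bsub>Omega_sub q m s\<^esub>" by (simp add: coboundaries_def)
    then show ?thesis using C.zero_closed C.coord_zero by (simp add: top_coord_def)
  next
    case (Suc r)
    with \<open>\<omega> \<in> ?B\<close> obtain \<eta> where \<eta>: "\<eta> \<in> carrier (Omega_sub q m r)" "\<omega> = dR q r \<eta>"
      by (auto simp: coboundaries_def)
    then have "form_coord q \<eta> \<in> bounded_forms (m * qchar q - 1) r" by (simp add: carrier_Omega_sub)
    then show ?thesis
      using \<eta> Suc dR_Omega_sub[OF \<eta>(1)]
      by (simp add: cocycles_coord dcoord_dcoord[OF q] top_coord_def dcoord_top)
  qed
next
  fix \<omega> :: "('n \<Rightarrow> nat) \<Rightarrow> ('n free_word \<Rightarrow>\<^sub>0 'k) set"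
  assume "\<omega> \<in> ?K"
  then have \<omega>: "\<omega> \<in> carrier (Omega_sub q m s)" "dcoord q (form_coord q \<omega>) = (\<lambda>_. 0)"
    and top: "\<And>S. form_coord q \<omega> (top_exp (m * qchar q - 1) S, S) = 0"
    by (auto simp: cocycles_coord top_coord_def)
  interpret V: coordinates "Omega_sub q m s :: ('k, ('n \<Rightarrow> nat) \<Rightarrow> _) module" "form_coord q"
    by (rule coordinates_Omega_sub)
  have "form_coord q \<omega> \<in> bounded_forms (m * qchar q - 1) s"
    using \<omega>(1) by (simp add: carrier_Omega_sub)
  from cocycle_is_coboundary[OF q this \<omega>(2) top] obtain G where G: "dcoord q G = form_coord q \<omega>"
    "\<And>\<alpha> T. G (\<alpha>, T) \<noteq> 0 \<Longrightarrow> Suc (card T) = s \<and> (\<forall>i. \<alpha> i \<le> m * qchar q - 1)"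
    by blast
  show "\<omega> \<in> ?B"
  proof (cases s)
    case 0
    \<comment> \<open>In degree 0 the degree condition on \<open>G\<close> cannot hold, so the
      primitive and with it the cocycle vanish.\<close>
    then have "G = (\<lambda>_. 0)" using G(2) by (metis nat.distinct(1) surj_pair)
    then have "form_coord q \<omega> b = 0" for b using G(1) dcoord_zero[of q] by metis
    then have "\<omega> = \<zero>\<^bsub>Omega_sub q m s\<^esub>" using \<omega>(1) by (intro V.coord_inj) auto
    then show ?thesis using 0 by (simp add: coboundaries_def)
  next
    case (Suc r)
    then have "G \<in> bounded_forms (m * qchar q - 1) r"
      using G(2) unfolding bounded_forms_def by fastforce
    then obtain \<eta> where \<eta>: "\<eta> \<in> carrier (Omega_sub q m r)" "form_coord q \<eta> = G"
      using Omega_sub_coordinate_exists by blast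
    have "dR q r \<eta> = \<omega>"
    proof (rule V.coord_inj)
      show "dR q r \<eta> \<in> carrier (Omega_sub q m s)" using dR_Omega_sub(1)[OF \<eta>(1)] Suc by simp
      show "form_coord q (dR q r \<eta>) b = form_coord q \<omega> b" for b
        by (simp add: dR_Omega_sub(2)[OF \<eta>(1)] \<eta>(2) G(1))
    qed (rule \<omega>(1))
    then show ?thesis using Suc \<eta>(1) by (auto simp: coboundaries_def)
  qed
qed

lemma quotient_coordinates_cohomology:
  fixes q :: "'k::field_char_0"
  assumes "q \<noteq> 0"
  shows "quotient_coordinates
    ((Omega_sub q m s)\<lparr>carrier := cocycles q m s\<rparr> :: ('k, ('n::{finite,linorder} \<Rightarrow> nat) \<Rightarrow> _) module)
    (form_coord q) (coboundaries q m s) (top_coord q m)"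
proof -
  interpret C: coordinates "(Omega_sub q m s)\<lparr>carrier := cocycles q m s\<rparr> :: ('k, ('n \<Rightarrow> nat) \<Rightarrow> _) module" "form_coord q"
    by (rule coordinates_cocycles)
  show ?thesis
    using C.coord_add C.coord_smult
    by unfold_locales (simp_all add: top_coord_def coboundaries_eq_kernel[OF assms])
qed

text \<open>The hypothesis \<open>pos\<close> makes the integer exponent in \<open>top_form\<close>
  agree with the truncated subtraction in \<open>top_exp\<close>.\<close>

lemma form_coord_top_form:
  fixes js :: "'n::{finite,linorder} list"
  assumes js: "js \<in> incr_seqs s" and pos: "m * qchar q \<ge> 1"
  shows "form_coord q (top_form q m js) (\<alpha>, S) =
    (if \<alpha> = top_exp (m * qchar q - 1) (set js) \<and> S = set js then 1 else 0)"
proof -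
  have sorted: "sorted_wrt (<) js" using js by (simp add: incr_seqs_def)
  then have "distinct js" by (simp add: strict_sorted_iff)
  then have "(\<Sum>j\<leftarrow>js. (int m * int (qchar q) - 1) * eps j i)
      = int (top_exp (m * qchar q - 1) (set js) i)" for i
    using pos by (induction js) (auto simp: top_exp_def eps_def of_nat_diff)
  then have eq: "top_form q m js = x_tensor (wedge q) (\<lambda>i. int (top_exp (m * qchar q - 1) (set js) i)) (dx_wedge q js)"
    by (simp add: top_form_def)
  have coord: "wedge_coord q (dx_wedge q js) = unit_coord (set js)"
    by (simp add: dx_wedge_coset wcoord_word_elem[OF sorted])
  show ?thesis
    unfolding eq form_coord_x_tensor coord by (auto simp: unit_coord_def fun_eq_iff)
qed

text \<open>In a direction of \<open>js\<close> the factor \<open>dx_j\<close> is already present;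
  in any other direction the exponent is 0 and cannot be lowered.\<close>

lemma top_form_cocycle:
  fixes js :: "'n::{finite,linorder} list"
  assumes js: "js \<in> incr_seqs s" and pos: "m * qchar q \<ge> 1"
  shows "top_form q m js \<in> cocycles q m s"
proof -
  have "dx_wedge q js \<in> carrier (wedge q)" by (simp add: dx_wedge_coset carrier_wedge)
  then have "top_form q m js \<alpha> \<in> carrier (wedge q)" for \<alpha>
    by (simp add: top_form_def x_tensor_def)
  moreover have "card (set js) = s"
    using js distinct_card[of js] by (auto simp: incr_seqs_def strict_sorted_iff)
  then have "form_coord q (top_form q m js) \<in> bounded_forms (m * qchar q - 1) s"
    by (auto simp: bounded_forms_def form_coord_top_form[OF assms] top_exp_def split: if_splits)
  moreover have "dcoord q (form_coord q (top_form q m js)) (\<alpha>, S) = 0" for \<alpha> S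
  proof -
    have "form_coord q (top_form q m js) (\<alpha>(j := Suc (\<alpha> j)), S - {j}) = 0" for j
    proof -
      have False if "\<alpha>(j := Suc (\<alpha> j)) = top_exp (m * qchar q - 1) (set js)" "S - {j} = set js"
      proof -
        have "j \<notin> set js" using that(2) by auto
        then show False using fun_cong[OF that(1), of j] by (simp add: top_exp_def)
      qed
      then show ?thesis by (auto simp: form_coord_top_form[OF assms])
    qed
    then show ?thesis by (simp add: dcoord_def)
  qed
  ultimately show ?thesis by (auto simp: cocycles_coord carrier_Omega_sub)
qed

lemma bij_betw_incr_seqs: "bij_betw set (incr_seqs s :: 'n::{finite,linorder} list set) {S. card S = s}"
proof (rule bij_betw_byWitness[where f' = sorted_list_of_set])
  show "\<forall>js\<in>incr_seqs s. sorted_list_of_set (set js) = (js :: 'n list)"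
    by (auto simp: incr_seqs_def strict_sorted_iff intro: sorted_list_of_set.idem_if_sorted_distinct)
  show "set ` incr_seqs s \<subseteq> {S :: 'n set. card S = s}"
    by (auto simp: incr_seqs_def strict_sorted_iff distinct_card)
  show "sorted_list_of_set ` {S :: 'n set. card S = s} \<subseteq> incr_seqs s"
    by (auto simp: incr_seqs_def)
qed simp

theorem theorem4p6:
  fixes q :: "'k::{alg_closed_field, field_char_0}"
    and l m s :: nat
  assumes "q \<noteq> 0" and "q \<noteq> 1" and "q \<noteq> - 1"
    and "CARD('n) \<ge> 3"
    and "qchar q = l" and "l \<ge> 3" and "m \<ge> 1"
    and "s \<le> CARD('n)"
  defines "H \<equiv> (cohomology q m s ::
    ('k, (('n::{finite,linorder} \<Rightarrow> nat) \<Rightarrow> ('n free_word \<Rightarrow>\<^sub>0 'k) set) set) module)"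
  shows "vectorspace class_ring H
    \<and> inj_on (\<lambda>js. coh_class q m s (top_form q m js)) (incr_seqs s :: 'n list set)
    \<and> vectorspace.basis class_ring H
        ((\<lambda>js. coh_class q m s (top_form q m js)) ` (incr_seqs s :: 'n list set))
    \<and> vectorspace.dim class_ring H = CARD('n) choose s"
proof -
  let ?B = "incr_seqs s :: 'n list set"
  interpret Q: quotient_coordinates
    "(Omega_sub q m s)\<lparr>carrier := cocycles q m s\<rparr> :: ('k, ('n \<Rightarrow> nat) \<Rightarrow> _) module"
    "form_coord q" "coboundaries q m s" "top_coord q m"
    by (rule quotient_coordinates_cohomology[OF assms(1)])
  interpret H: coordinates H Q.qcoord
    unfolding H_def cohomology_def by (rule Q.coordinates_quot)
  have pos: "m * qchar q \<ge> 1" using assms by simp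
  \<comment> \<open>\<open>coh_class\<close> forms the coset in the ambient module,
    \<open>Q.coset\<close> in the subspace of cocycles; both have the same addition.\<close>
  have coh_class: "coh_class q m s \<omega> = Q.coset \<omega>" for \<omega>
    by (simp add: coh_class_def a_r_coset_def')
  have top: "top_form q m js \<in> cocycles q m s" if "js \<in> ?B" for js
    using top_form_cocycle[OF that pos] .
  have carrier_H: "carrier H = Q.coset ` cocycles q m s"
    unfolding H_def cohomology_def Q.carrier_quot by simp
  have card: "card ?B = CARD('n) choose s"
    using bij_betw_same_card[OF bij_betw_incr_seqs[where 'n = 'n, of s]] n_subsets[of "UNIV :: 'n set" s] by simp
  have "inj_on (\<lambda>js. coh_class q m s (top_form q m js)) ?B \<and>
    vectorspace.basis class_ring H ((\<lambda>js. coh_class q m s (top_form q m js)) ` ?B) \<and>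
    vectorspace.dim class_ring H = card ?B"
  \<comment> \<open>Strictly increasing lists index the classes and their underlying sets index the
    top coefficients, which form the dual family.\<close>
  proof (rule H.dual_basis[where \<iota> = set])
    show "finite ?B" using bij_betw_finite[OF bij_betw_incr_seqs[where 'n = 'n, of s]] by simp
    show "coh_class q m s (top_form q m js) \<in> carrier H" if "js \<in> ?B" for js
      using top[OF that] by (simp add: carrier_H coh_class)
    show "Q.qcoord (coh_class q m s (top_form q m js)) (set js') = (if js = js' then 1 else 0)"
      if "js \<in> ?B" "js' \<in> ?B" for js js'
    proof -
      have "set js = set js' \<longleftrightarrow> js = js'"
        using bij_betw_imp_inj_on[OF bij_betw_incr_seqs] that by (auto dest: inj_onD)
      then show ?thesis
        using top[OF that(1)] by (auto simp: coh_class top_coord_def form_coord_top_form[OF that(1) pos])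
    qed
    show "X = Y" if XY: "X \<in> carrier H" "Y \<in> carrier H"
      and eq: "\<And>js. js \<in> ?B \<Longrightarrow> Q.qcoord X (set js) = Q.qcoord Y (set js)" for X Y
    proof (rule H.coord_inj[OF XY])
      fix S :: "'n set"
      \<comment> \<open>A degree \<open>s\<close> form has no coefficients on sets of another size,
        so the coordinates at underlying sets of lists in \<open>?B\<close> suffice to separate
        classes.\<close>
      have zero: "Q.qcoord Z S = 0" if Z: "Z \<in> carrier H" and "card S \<noteq> s" for Z
      proof -
        obtain \<omega> where \<omega>: "\<omega> \<in> cocycles q m s" "Z = Q.coset \<omega>" using Z by (auto simp: carrier_H)
        then have "form_coord q \<omega> \<in> bounded_forms (m * qchar q - 1) s"
          by (simp add: cocycles_coord carrier_Omega_sub)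
        then show ?thesis using \<omega> that(2) by (auto simp: top_coord_def bounded_forms_def)
      qed
      show "Q.qcoord X S = Q.qcoord Y S"
      proof (cases "card S = s")
        case True
        then obtain js where "js \<in> ?B" "S = set js"
          using bij_betw_imp_surj_on[OF bij_betw_incr_seqs[where 'n = 'n, of s]] by auto
        then show ?thesis using eq by simp
      qed (simp add: zero XY)
    qed
  qed
  with H.vectorspace show ?thesis unfolding card by blast
qed

end
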